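(* Let $N,d\ge 1$ be integers. Let $x_{ij}$, $1\le i\le N$, $1\le j\le d$, be independent random variables, each uniformly distributed on $[-1,1]$. Let $\mathbf{p}_i=(x_{i1},\dots,x_{id})^T\in[-1,1]^d$ for $1\le i\le N$, and let $\boldsymbol{\Delta}\in\mathbb{R}^{N\times N}$ be the associated Euclidean distance matrix, $\boldsymbol{\Delta}(i,j)=\|\mathbf{p}_i-\mathbf{p}_j\|_2^2$. Set $$\zeta=5d^2+4d+45,\qquad \theta=\frac{90\left(1+d+d^2\right)}{\zeta-\sqrt{\zeta^2-720d}}.$$ Let $t\in(0,1)$ and $\gamma\in(0,1]$. If $$N\ \ge\ \frac{2\theta\left(\log(d+2)-\log\gamma\right)}{(1-t)^2},$$ then, with probability at least $1-\gamma$, the matrix $\boldsymbol{\Delta}$, with worst-case rank $r=d+2$, obeys assumptions $\mathbf{A0}$ and $\mathbf{A1}$ with $$\mu_0=\frac{\theta}{t(d+2)}\qquad\text{and}\qquad \mu_1=\frac{\theta}{t\sqrt{d+2}}.$$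
   Context: For a subspace $U\subseteq\mathbb{R}^N$ of dimension $r$, with orthogonal projection $\mathbf{P}_U$ onto $U$ and standard basis $\mathbf{e}_1,\dots,\mathbf{e}_N$ of $\mathbb{R}^N$, the coherence of $U$ is $$\mu(U)=\frac{N}{r}\max_{1\le i\le N}\|\mathbf{P}_U\mathbf{e}_i\|_2^2 .$$ Let $\mathbf{M}\in\mathbb{R}^{K\times L}$ have rank $r$, with compact singular value decomposition $\mathbf{M}=\sum_{i=1}^r\sigma_i\mathbf{u}_i\mathbf{v}_i^T$, and let $U=\mathrm{span}\{\mathbf{u}_i\}$ and $V=\mathrm{span}\{\mathbf{v}_i\}$ be its column and row spaces. For positive constants $\mu_0,\mu_1$, the assumptions are: $\mathbf{A0}$: $\max\{\mu(U),\mu(V)\}\le\mu_0$. $\mathbf{A1}$: $\left\|\sum_{i=1}^r\mathbf{u}_i\mathbf{v}_i^T\right\|_\infty\le\mu_1\sqrt{\dfrac{r}{KL}}$, where $\|\cdot\|_\infty$ denotes the largest absolute value of an entry. Every Euclidean distance matrix of $N$ points in $\mathbb{R}^d$ has rank at most $d+2$; "worst-case rank $r=d+2$" means that the normalizing factor $r$ in $\mathbf{A0}$ and $\mathbf{A1}$ for $\mathbf{M}=\boldsymbol{\Delta}$ (with $K=L=N$) is $d+2$. *)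

theory Defs
  imports "HOL-Probability.Probability"
begin

section \<open>Orthogonal projection and coherence\<close>

definition orth_proj :: "'a::euclidean_space set \<Rightarrow> 'a \<Rightarrow> 'a" where
  "orth_proj U x = (THE y. y \<in> U \<and> (\<forall>w\<in>U. orthogonal (x - y) w))"

lemma orth_proj_unique_existence:
  fixes U :: "'a::euclidean_space set"
  assumes "subspace U"
  shows "\<exists>!y. y \<in> U \<and> (\<forall>w\<in>U. orthogonal (x - y) w)"
proof -
  obtain y z where y: "y \<in> span U" and z: "\<And>w. w \<in> span U \<Longrightarrow> orthogonal z w" and x: "x = y + z"
    using orthogonal_subspace_decomp_exists[of U x] by metis
  have U: "span U = U" using assms by simp
  have "y' = y" if "y' \<in> U" "\<forall>w\<in>U. orthogonal (x - y') w" for y'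
  proof -
    have mem: "y - y' \<in> U" using that y U assms subspace_diff by auto
    have "(x - y') \<bullet> (y - y') = 0" "z \<bullet> (y - y') = 0"
      using that(2) mem z U by (auto simp: orthogonal_def)
    then have "(y - y') \<bullet> (y - y') = 0" by (simp add: x inner_diff_left inner_add_left)
    then show ?thesis by simp
  qed
  then show ?thesis using y z x U by (intro ex1I[of _ y]) auto
qed

text \<open>
  The normalizing factor \<open>r\<close> is an explicit argument. The usual coherence of \<open>U\<close> is
  \<open>coherence (dim U) U\<close>; a worst-case rank replaces \<open>dim U\<close> by an upper bound for it.
\<close>

definition coherence :: "nat \<Rightarrow> (real^'n) set \<Rightarrow> real" where
  "coherence r U =
     real CARD('n) / real r * Max (range (\<lambda>i::'n. (norm (orth_proj U (axis i 1)))\<^sup>2))"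

section \<open>Compact singular value decomposition\<close>

definition outer :: "real^'m \<Rightarrow> real^'n \<Rightarrow> real^'n^'m" where
  "outer u v = (\<chi> i j. u $ i * v $ j)"

definition orthonormal_family :: "nat \<Rightarrow> (nat \<Rightarrow> 'a::real_inner) \<Rightarrow> bool" where
  "orthonormal_family r u \<longleftrightarrow> (\<forall>i\<in>{1..r}. \<forall>j\<in>{1..r}. u i \<bullet> u j = (if i = j then 1 else 0))"

definition compact_svd ::
    "real^'n^'m \<Rightarrow> (nat \<Rightarrow> real) \<Rightarrow> (nat \<Rightarrow> real^'m) \<Rightarrow> (nat \<Rightarrow> real^'n) \<Rightarrow> bool" where
  "compact_svd M \<sigma> u v \<longleftrightarrow>
     (\<forall>i\<in>{1..rank M}. \<sigma> i > 0) \<and>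
     orthonormal_family (rank M) u \<and> orthonormal_family (rank M) v \<and>
     M = (\<Sum>i=1..rank M. \<sigma> i *\<^sub>R outer (u i) (v i))"

lemma outer_mult_vec: "outer u v *v x = (v \<bullet> x) *\<^sub>R u"
  by (simp add: outer_def vec_eq_iff matrix_vector_mult_def inner_vec_def sum_distrib_left algebra_simps)

lemma sum_outer_mult_vec:
  "(\<Sum>i\<in>I. \<sigma> i *\<^sub>R outer (u i) (v i)) *v x = (\<Sum>i\<in>I. (\<sigma> i * (v i \<bullet> x)) *\<^sub>R u i)"
proof (cases "finite I")
  case True
  then show ?thesis
    by (induction I rule: finite_induct)
       (auto simp: matrix_vector_mult_add_rdistrib outer_mult_vec scaleR_matrix_vector_assoc[symmetric])
qed auto

lemma orthonormal_expansion_mult: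
  assumes M: "M = (\<Sum>i=1..k. \<sigma> i *\<^sub>R outer (u i) (v i))"
    and v: "orthonormal_family k v" and j: "j \<in> {1..k}"
  shows "M *v v j = \<sigma> j *\<^sub>R u j"
proof -
  have "M *v v j = (\<Sum>i=1..k. (\<sigma> i * (v i \<bullet> v j)) *\<^sub>R u i)"
    unfolding M by (rule sum_outer_mult_vec)
  also have "\<dots> = (\<Sum>i=1..k. if i = j then \<sigma> j *\<^sub>R u j else 0)"
    using v j by (intro sum.cong) (auto simp: orthonormal_family_def)
  also have "\<dots> = \<sigma> j *\<^sub>R u j" using j by simp
  finally show ?thesis .
qed

lemma orthonormal_expansion_range:
  assumes M: "M = (\<Sum>i=1..k. \<sigma> i *\<^sub>R outer (u i) (v i))"
    and v: "orthonormal_family k v" and pos: "\<forall>i\<in>{1..k}. \<sigma> i > 0"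
  shows "range ((*v) M) = span (u ` {1..k})"
proof
  show "range ((*v) M) \<subseteq> span (u ` {1..k})"
  proof (rule image_subsetI)
    fix x
    show "M *v x \<in> span (u ` {1..k})"
      unfolding M sum_outer_mult_vec by (intro span_sum span_scale span_base imageI)
  qed
  have "u j \<in> range ((*v) M)" if j: "j \<in> {1..k}" for j
  proof -
    have "M *v ((1 / \<sigma> j) *\<^sub>R v j) = (1 / \<sigma> j) *\<^sub>R (M *v v j)"
      by (simp add: matrix_vector_mult_scaleR)
    also have "\<dots> = u j"
      using bspec[OF pos j] by (simp add: orthonormal_expansion_mult[OF M v j])
    finally show ?thesis by (metis rangeI)
  qed
  moreover have "subspace (range ((*v) M))"
    by (intro linear_subspace_image matrix_vector_mul_linear subspace_UNIV)
  ultimately show "span (u ` {1..k}) \<subseteq> range ((*v) M)"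
    by (intro span_minimal) auto
qed

lemma orthonormal_expansion_rank:
  assumes M: "M = (\<Sum>i=1..k. \<sigma> i *\<^sub>R outer (u i) (v i))"
    and u: "orthonormal_family k u" and v: "orthonormal_family k v"
    and pos: "\<forall>i\<in>{1..k}. \<sigma> i > 0"
  shows "rank M = k"
proof -
  have inj: "inj_on u {1..k}"
  proof (rule inj_onI, rule ccontr)
    fix i j assume ij: "i \<in> {1..k}" "j \<in> {1..k}" "u i = u j" "i \<noteq> j"
    have "u i \<bullet> u j = 0" "u i \<bullet> u i = 1"
      using u ij(1,2,4) by (auto simp: orthonormal_family_def)
    then show False using ij(3) by simp
  qed
  have "pairwise orthogonal (u ` {1..k})"
    using u unfolding pairwise_def orthogonal_def orthonormal_family_def by fastforce
  moreover have "0 \<notin> u ` {1..k}"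
    using u by (force simp: orthonormal_family_def)
  ultimately have "independent (u ` {1..k})"
    by (rule pairwise_orthogonal_independent)
  then have "dim (span (u ` {1..k})) = k"
    using card_image[OF inj] by (simp add: dim_eq_card_independent)
  then show ?thesis
    by (simp add: rank_dim_range orthonormal_expansion_range[OF M v pos])
qed

lemma top_singular_pair:
  fixes M :: "real^'n^'m"
  assumes "M \<noteq> 0"
  obtains s u v where "s > 0" "norm u = 1" "norm v = 1" "M *v v = s *\<^sub>R u"
    "\<And>w. v \<bullet> w = 0 \<Longrightarrow> u \<bullet> (M *v w) = 0"
proof -
  have "\<exists>v\<in>sphere 0 1. \<forall>w\<in>sphere 0 1. norm (M *v w) \<le> norm (M *v v)"
    by (intro continuous_attains_sup continuous_intros) (auto intro: exI[of _ "axis _ 1"])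
  then obtain v :: "real^'n" where v: "norm v = 1"
    and max: "\<And>w. norm w = 1 \<Longrightarrow> norm (M *v w) \<le> norm (M *v v)" by auto
  define s where "s = norm (M *v v)"
  have bound: "norm (M *v w) \<le> s * norm w" for w
  proof (cases "w = 0")
    case False
    have "norm (M *v ((1 / norm w) *\<^sub>R w)) \<le> s"
      unfolding s_def using False by (intro max) simp
    then show ?thesis using False by (simp add: matrix_vector_mult_scaleR field_simps)
  qed simp
  have "s \<noteq> 0"
  proof
    assume "s = 0"
    then have "\<And>w. M *v w = 0" using bound by simp
    then show False using assms by (simp add: matrix_eq)
  qed
  then have s: "s > 0" by (simp add: s_def)
  define u where "u = (1 / s) *\<^sub>R (M *v v)"
  have nu: "norm u = 1" using s by (simp add: u_def s_def)
  have Mv: "M *v v = s *\<^sub>R u" using s by (simp add: u_def)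
  have "u \<bullet> (M *v w) = 0" if w: "v \<bullet> w = 0" for w
  proof (rule ccontr)
    define a where "a = u \<bullet> (M *v w)"
    assume "u \<bullet> (M *v w) \<noteq> 0"
    then have a: "a \<noteq> 0" by (simp add: a_def)
    have ineq: "2 * s * e * a \<le> s\<^sup>2 * e\<^sup>2 * (w \<bullet> w)" for e
    proof -
      have "s + e * a = u \<bullet> (M *v (v + e *\<^sub>R w))"
        using nu by (simp add: matrix_vector_right_distrib matrix_vector_mult_scaleR Mv
            inner_add_right a_def norm_eq_1)
      also have "\<bar>\<dots>\<bar> \<le> norm u * norm (M *v (v + e *\<^sub>R w))" by (rule Cauchy_Schwarz_ineq2)
      also have "\<dots> \<le> s * norm (v + e *\<^sub>R w)" using bound nu by simp
      finally have "\<bar>s + e * a\<bar> \<le> s * norm (v + e *\<^sub>R w)" .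
      then have "\<bar>s + e * a\<bar>\<^sup>2 \<le> (s * norm (v + e *\<^sub>R w))\<^sup>2" by (intro power_mono) auto
      moreover have "(norm (v + e *\<^sub>R w))\<^sup>2 = 1 + e\<^sup>2 * (w \<bullet> w)"
        unfolding power2_norm_eq_inner using v w
        by (simp add: inner_add_left inner_add_right inner_commute norm_eq_1 power2_eq_square)
      ultimately have "(s + e * a)\<^sup>2 \<le> s\<^sup>2 * (1 + e\<^sup>2 * (w \<bullet> w))"
        by (simp add: power_mult_distrib)
      then have "s\<^sup>2 + 2 * s * e * a + (e * a)\<^sup>2 \<le> s\<^sup>2 + s\<^sup>2 * e\<^sup>2 * (w \<bullet> w)"
        by (simp add: power2_sum algebra_simps)
      then show ?thesis using zero_le_power2[of "e * a"] by linarith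
    qed
    define c where "c = w \<bullet> w + 1"
    have c: "c > 0" "w \<bullet> w < c" using inner_ge_zero[of w] unfolding c_def by linarith+
    define e where "e = a / (s * c)"
    have ea: "e\<^sup>2 * s\<^sup>2 * c = a\<^sup>2 / c" "s * e * a = a\<^sup>2 / c"
      using s c by (auto simp: e_def field_simps power2_eq_square)
    have "2 * (a\<^sup>2 / c) \<le> s\<^sup>2 * e\<^sup>2 * (w \<bullet> w)" using ineq[of e] ea(2) by (simp add: mult.assoc)
    also have "\<dots> \<le> s\<^sup>2 * e\<^sup>2 * c" using c by (intro mult_left_mono) auto
    also have "\<dots> = a\<^sup>2 / c" using ea(1) by (simp add: mult.commute)
    finally have "a\<^sup>2 / c \<le> 0" by simp
    moreover have "a\<^sup>2 / c > 0" using a c by simp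
    ultimately show False by simp
  qed
  with s nu v Mv show thesis using that by blast
qed

lemma orthonormal_expansion_exists:
  fixes M :: "real^'n^'m"
  shows "\<exists>k \<sigma> u v. (\<forall>i\<in>{1..k}. \<sigma> i > 0) \<and> orthonormal_family k u \<and> orthonormal_family k v \<and>
     M = (\<Sum>i=1..k. \<sigma> i *\<^sub>R outer (u i) (v i))"
proof (induction "rank M" arbitrary: M rule: less_induct)
  case less
  show ?case
  proof (cases "M = 0")
    case True
    then show ?thesis by (intro exI[of _ 0]) (auto simp: orthonormal_family_def)
  next
    case False
    then obtain s u0 v0 where s: "s > 0" and nu: "norm u0 = 1" and nv: "norm v0 = 1"
      and Mv: "M *v v0 = s *\<^sub>R u0" and orth: "\<And>w. v0 \<bullet> w = 0 \<Longrightarrow> u0 \<bullet> (M *v w) = 0"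
      using top_singular_pair by blast
    define M' where "M' = M - s *\<^sub>R outer u0 v0"
    have M'x: "M' *v x = M *v (x - (v0 \<bullet> x) *\<^sub>R v0)" for x
      by (simp add: M'_def matrix_vector_mult_diff_rdistrib matrix_vector_mult_diff_distrib
          scaleR_matrix_vector_assoc[symmetric] outer_mult_vec matrix_vector_mult_scaleR Mv mult.commute)
    have u0M': "u0 \<bullet> (M' *v x) = 0" for x
      unfolding M'x using nv by (intro orth) (simp add: inner_diff_right norm_eq_1)
    have M'v0: "M' *v v0 = 0" using nv by (simp add: M'x norm_eq_1)
    have u0: "u0 \<in> range ((*v) M)"
    proof -
      have "M *v ((1 / s) *\<^sub>R v0) = u0" using s by (simp add: matrix_vector_mult_scaleR Mv)
      then show ?thesis by (metis rangeI)
    qed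
    have sub: "subspace (range ((*v) M))" "subspace (range ((*v) M'))"
      by (intro linear_subspace_image matrix_vector_mul_linear subspace_UNIV)+
    have "u0 \<notin> range ((*v) M')" using u0M' nu by (force simp: norm_eq_1)
    then have "range ((*v) M') \<subset> range ((*v) M)" using u0 M'x by blast
    then have "rank M' < rank M"
      unfolding rank_dim_range using sub by (intro dim_psubset) (simp add: span_eq_iff[THEN iffD2])
    from less[OF this] obtain k \<sigma> u v where pos: "\<forall>i\<in>{1..k}. \<sigma> i > 0"
      and u: "orthonormal_family k u" and v: "orthonormal_family k v"
      and M': "M' = (\<Sum>i=1..k. \<sigma> i *\<^sub>R outer (u i) (v i))" by blast
    have u0u: "u0 \<bullet> u i = 0" if i: "i \<in> {1..k}" for i
    proof -
      have "\<sigma> i * (u0 \<bullet> u i) = 0"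
        using u0M'[of "v i"] by (simp add: orthonormal_expansion_mult[OF M' v i])
      then show ?thesis using pos i by fastforce
    qed
    have v0v: "v0 \<bullet> v i = 0" if i: "i \<in> {1..k}" for i
    proof -
      have "0 = u i \<bullet> (M' *v v0)" by (simp add: M'v0)
      also have "\<dots> = (\<Sum>j=1..k. \<sigma> j * (v j \<bullet> v0) * (u i \<bullet> u j))"
        unfolding M' by (simp add: sum_outer_mult_vec inner_sum_right)
      also have "\<dots> = (\<Sum>j=1..k. if j = i then \<sigma> i * (v i \<bullet> v0) else 0)"
        using u i by (intro sum.cong) (auto simp: orthonormal_family_def)
      also have "\<dots> = \<sigma> i * (v i \<bullet> v0)" using i by simp
      finally show ?thesis using pos i by (force simp: inner_commute)
    qed
    define \<sigma>' u' v' where "\<sigma>' = \<sigma>(Suc k := s)" and "u' = u(Suc k := u0)" and "v' = v(Suc k := v0)"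
    have "orthonormal_family (Suc k) u'" "orthonormal_family (Suc k) v'"
      using u v u0u v0v nu nv
      by (auto simp: orthonormal_family_def u'_def v'_def norm_eq_1 inner_commute le_Suc_eq)
    moreover have "\<forall>i\<in>{1..Suc k}. \<sigma>' i > 0" using pos s by (auto simp: \<sigma>'_def)
    moreover have "M = (\<Sum>i=1..Suc k. \<sigma>' i *\<^sub>R outer (u' i) (v' i))"
    proof -
      have "(\<Sum>i=1..k. \<sigma>' i *\<^sub>R outer (u' i) (v' i)) = M'"
        unfolding M' by (intro sum.cong) (auto simp: \<sigma>'_def u'_def v'_def)
      then show ?thesis by (simp add: M'_def \<sigma>'_def u'_def v'_def)
    qed
    ultimately show ?thesis by blast
  qed
qed

lemma compact_svd_exists:
  fixes M :: "real^'n^'m"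
  shows "\<exists>\<sigma> u v. compact_svd M \<sigma> u v"
proof -
  obtain k \<sigma> u v where *: "\<forall>i\<in>{1..k}. \<sigma> i > 0" "orthonormal_family k u"
      "orthonormal_family k v" "M = (\<Sum>i=1..k. \<sigma> i *\<^sub>R outer (u i) (v i))"
    using orthonormal_expansion_exists[of M] by blast
  have "rank M = k"
    by (rule orthonormal_expansion_rank[OF *(4,2,3,1)])
  then have "compact_svd M \<sigma> u v"
    unfolding compact_svd_def using * by simp
  then show ?thesis by blast
qed

section \<open>The incoherence assumptions\<close>

definition max_entry :: "real^'n^'m \<Rightarrow> real" where
  "max_entry W = Max {\<bar>W $ i $ j\<bar> | i j. True}"

text \<open>
  The number of singular vectors is the actual rank of \<open>M\<close>, whereas \<open>r\<close> is only the normalizing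
  factor. The spans and the sum below do not depend on the chosen decomposition, so it is
  quantified universally; by \<open>compact_svd_exists\<close> this is never vacuous.
\<close>

definition A0 :: "nat \<Rightarrow> real \<Rightarrow> real^'n^'m \<Rightarrow> bool" where
  "A0 r \<mu>\<^sub>0 M \<longleftrightarrow>
     (\<forall>\<sigma> u v. compact_svd M \<sigma> u v \<longrightarrow>
        max (coherence r (span (u ` {1..rank M}))) (coherence r (span (v ` {1..rank M}))) \<le> \<mu>\<^sub>0)"

definition A1 :: "nat \<Rightarrow> real \<Rightarrow> real^'n^'m \<Rightarrow> bool" where
  "A1 r \<mu>\<^sub>1 M \<longleftrightarrow>
     (\<forall>\<sigma> u v. compact_svd M \<sigma> u v \<longrightarrow>
        max_entry (\<Sum>i=1..rank M. outer (u i) (v i))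
          \<le> \<mu>\<^sub>1 * sqrt (real r / (real CARD('m) * real CARD('n))))"

section \<open>Euclidean distance matrices\<close>

definition edm :: "('n \<Rightarrow> real^'d) \<Rightarrow> real^'n^'n" where
  "edm p = (\<chi> i j. (norm (p i - p j))\<^sup>2)"

definition zeta :: "nat \<Rightarrow> real" where
  "zeta d = 5 * (real d)\<^sup>2 + 4 * real d + 45"

definition theta :: "nat \<Rightarrow> real" where
  "theta d = 90 * (1 + real d + (real d)\<^sup>2) / (zeta d - sqrt ((zeta d)\<^sup>2 - 720 * real d))"

end

theory Submission
  imports Defs "HOL-Real_Asymp.Real_Asymp"
begin

text \<open>
  Put \<open>X\<^sub>i = (1, p\<^sub>i, \<parallel>p\<^sub>i\<parallel>\<^sup>2)\<close>. The column space of the distance matrix lies in the image of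
  \<open>v \<mapsto> (X\<^sub>i \<bullet> v)\<^sub>i\<close>, so once the least eigenvalue of \<open>\<Sum>\<^sub>i X\<^sub>i X\<^sub>i\<^sup>T\<close> is at least \<open>\<beta>\<close>, every leverage
  score is at most \<open>R / \<beta>\<close> with \<open>R = 1 + d + d\<^sup>2 \<ge> \<parallel>X\<^sub>i\<parallel>\<^sup>2\<close>; this gives A0 and, by Cauchy-Schwarz, A1. The
  eigenvalue is controlled by the matrix Chernoff lower tail. Matrix exponentials and the
  Golden-Thompson inequality are avoided: \<open>tr exp (-s S)\<close> is replaced by \<open>tr (1 - s S / m)\<^sup>m\<close> for even
  \<open>m\<close>, a polynomial whose change under a rank-one update of \<open>S\<close> is controlled by log-convexity of
  the moments \<open>x \<bullet> T\<^sup>j x\<close>, and \<open>m \<rightarrow> \<infinity>\<close> at the end. The incoherence event is measurable because the set of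
  matrices violating A0 or A1 is a countable union of compact sets.
\<close>

section \<open>Moments of a positive definite contraction\<close>

text \<open>In an exponential version the update factor would be
  \<open>exp (- s x x^T) = I - ((1 - exp (- s |x|^2)) / |x|^2) x x^T\<close>. The polynomial version
  recovers this coefficient as \<open>(1 - exp (- s K)) / K\<close> with \<open>K = R / l\<close>,
  from a differential inequality along the path \<open>T - \<tau> x x^T\<close>; here
  \<open>l\<close> is a lower spectral bound that tends to 1 as the degree grows. The resulting
  bound is linear in \<open>x x^T\<close>, so averaging over one independent vector involves only
  its second moment matrix, whose least eigenvalue \<kappa> turns the update into a scalar factor.
  Even degree makes the trace a sum of squared norms, which dominates the power of the form at any
  single unit vector. The number \<theta> is \<open>R / \<kappa>\<close>. By symmetry of the uniform
  law, the second moment matrix splits into \<open>I / 3\<close> on the linear coordinates and a 2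
  by 2 block on the constant and quadratic ones; the square root in \<theta> comes from the
  characteristic polynomial of that block.\<close>

definition op_trace :: "('a::euclidean_space \<Rightarrow> 'a) \<Rightarrow> real" where
  "op_trace f = (\<Sum>b\<in>Basis. b \<bullet> f b)"

text \<open>The spectrum lies in \<open>[l, 1]\<close>. Strict positivity of \<open>l\<close> keeps
  all moments of a nonzero vector positive, so that they can be cancelled. In the application
  \<open>T\<close> is the identity minus a small multiple of a Gram operator.\<close>

locale pos_contraction =
  fixes T :: "'a::euclidean_space \<Rightarrow> 'a" and l :: real
  assumes linear: "linear T"
    and self_adjoint: "x \<bullet> T y = T x \<bullet> y"
    and l_pos: "0 < l"
    and lower: "l * (y \<bullet> y) \<le> y \<bullet> T y"
    and upper: "y \<bullet> T y \<le> y \<bullet> y"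
begin

lemma self_adjoint_power: "x \<bullet> (T ^^ n) y = (T ^^ n) x \<bullet> y"
  by (induction n arbitrary: x y) (simp_all add: self_adjoint funpow_swap1)

lemma moment_add: "x \<bullet> (T ^^ (i + j)) y = (T ^^ i) x \<bullet> (T ^^ j) y"
  by (simp add: funpow_add self_adjoint_power)

lemma form_nonneg: "0 \<le> y \<bullet> T y"
  using lower[of y] l_pos by (meson inner_ge_zero less_eq_real_def order_trans zero_le_mult_iff)

lemma form_pos: "y \<noteq> 0 \<Longrightarrow> 0 < y \<bullet> T y"
  using lower[of y] l_pos by (meson inner_gt_zero_iff less_le_trans mult_pos_pos)

lemma form_Cauchy_Schwarz: "(x \<bullet> T y)\<^sup>2 \<le> (x \<bullet> T x) * (y \<bullet> T y)"
proof (cases "y = 0")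
  case True
  then show ?thesis using linear_0[OF linear] by simp
next
  case False
  define c where "c = y \<bullet> T y"
  define b where "b = x \<bullet> T y"
  have c: "0 < c" using form_pos[OF False] by (simp add: c_def)
  have yx: "y \<bullet> T x = b" by (metis b_def inner_commute self_adjoint)
  have "0 \<le> (c *\<^sub>R x - b *\<^sub>R y) \<bullet> T (c *\<^sub>R x - b *\<^sub>R y)" by (rule form_nonneg)
  also have "\<dots> = c * (c * (x \<bullet> T x) - b\<^sup>2)"
    by (simp add: linear_diff[OF linear] linear_cmul[OF linear] inner_diff_left inner_diff_right
        yx b_def[symmetric] c_def[symmetric] power2_eq_square algebra_simps)
  finally have "0 \<le> c * (x \<bullet> T x) - b\<^sup>2" using c by (simp add: zero_le_mult_iff)
  then show ?thesis unfolding b_def c_def by (simp add: mult.commute)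
qed

lemma power_eq_0_iff: "(T ^^ n) x = 0 \<longleftrightarrow> x = 0"
proof (induction n)
  case (Suc n)
  then show ?case
    using form_pos[of "(T ^^ n) x"] linear_0[OF linear] by auto
qed simp

lemma moment_pos: assumes "x \<noteq> 0" shows "0 < x \<bullet> (T ^^ n) x"
proof -
  obtain i where "n = i + i \<or> n = Suc (i + i)" by (metis oddE evenE mult_2 Suc_eq_plus1)
  then show ?thesis
  proof
    assume "n = i + i"
    then show ?thesis using assms by (simp add: moment_add power_eq_0_iff)
  next
    assume "n = Suc (i + i)"
    then have "x \<bullet> (T ^^ n) x = (T ^^ i) x \<bullet> T ((T ^^ i) x)"
      using moment_add[of x i "Suc i" x] by simp
    then show ?thesis using form_pos assms by (simp add: power_eq_0_iff)
  qed
qed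

text \<open>Splitting the powers evenly leaves Cauchy-Schwarz for the inner product when
  \<open>n\<close> is even, and for the form \<open>y \<bullet> T z\<close> when \<open>n\<close> is
  odd.\<close>

lemma moment_log_convex:
  "(x \<bullet> (T ^^ Suc n) x)\<^sup>2 \<le> (x \<bullet> (T ^^ n) x) * (x \<bullet> (T ^^ Suc (Suc n)) x)"
proof -
  obtain i where "n = i + i \<or> n = Suc (i + i)" by (metis oddE evenE mult_2 Suc_eq_plus1)
  then show ?thesis
  proof
    assume n: "n = i + i"
    have "x \<bullet> (T ^^ n) x = (T ^^ i) x \<bullet> (T ^^ i) x"
      "x \<bullet> (T ^^ Suc n) x = (T ^^ i) x \<bullet> (T ^^ Suc i) x"
      "x \<bullet> (T ^^ Suc (Suc n)) x = (T ^^ Suc i) x \<bullet> (T ^^ Suc i) x"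
      using n moment_add[of x i i x] moment_add[of x i "Suc i" x] moment_add[of x "Suc i" "Suc i" x]
      by simp_all
    then show ?thesis using Cauchy_Schwarz_ineq by metis
  next
    assume n: "n = Suc (i + i)"
    have "x \<bullet> (T ^^ n) x = (T ^^ i) x \<bullet> T ((T ^^ i) x)"
      "x \<bullet> (T ^^ Suc n) x = (T ^^ i) x \<bullet> T ((T ^^ Suc i) x)"
      "x \<bullet> (T ^^ Suc (Suc n)) x = (T ^^ Suc i) x \<bullet> T ((T ^^ Suc i) x)"
      using n moment_add[of x i "Suc i" x] moment_add[of x i "Suc (Suc i)" x]
        moment_add[of x "Suc i" "Suc (Suc i)" x]
      by simp_all
    then show ?thesis using form_Cauchy_Schwarz by metis
  qed
qed

lemma moment_ratio_mono:
  assumes "x \<noteq> 0"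
  shows "(x \<bullet> (T ^^ Suc i) x) * (x \<bullet> (T ^^ (i + j)) x) \<le> (x \<bullet> (T ^^ i) x) * (x \<bullet> (T ^^ Suc (i + j)) x)"
proof (induction j)
  case 0
  then show ?case by simp
next
  case (Suc j)
  define a where "a n = x \<bullet> (T ^^ n) x" for n
  have pos: "0 < a n" for n using moment_pos[OF assms] by (simp add: a_def)
  have "a (Suc i) * a (i + j) \<le> a i * a (Suc (i + j))" using Suc by (simp add: a_def)
  moreover have "a (Suc (i + j)) * a (Suc (i + j)) \<le> a (i + j) * a (Suc (Suc (i + j)))"
    using moment_log_convex[of x "i + j"] by (simp add: a_def power2_eq_square)
  ultimately have "(a (Suc i) * a (i + j)) * (a (Suc (i + j)) * a (Suc (i + j)))
      \<le> (a i * a (Suc (i + j))) * (a (i + j) * a (Suc (Suc (i + j))))"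
    by (rule mult_mono) (auto intro!: mult_pos_pos less_imp_le pos)
  then have "(a (i + j) * a (Suc (i + j))) * (a (Suc i) * a (Suc (i + j)))
      \<le> (a (i + j) * a (Suc (i + j))) * (a i * a (Suc (Suc (i + j))))"
    by (simp add: algebra_simps)
  then have "a (Suc i) * a (Suc (i + j)) \<le> a i * a (Suc (Suc (i + j)))"
    using pos by (simp add: mult_le_cancel_left_pos mult_pos_pos)
  then show ?case by (simp add: a_def)
qed

text \<open>For the spectral measure of \<open>x\<close> this is the positive correlation of two
  increasing powers. Ratios of consecutive moments increase, so passing from \<open>i\<close> to
  \<open>Suc i\<close> multiplies the left side by a ratio no larger than the one on the
  right.\<close>

lemma moment_mult_le:
  "(x \<bullet> (T ^^ i) x) * (x \<bullet> (T ^^ j) x) \<le> (x \<bullet> x) * (x \<bullet> (T ^^ (i + j)) x)"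
proof (cases "x = 0")
  case False
  define a where "a n = x \<bullet> (T ^^ n) x" for n
  have pos: "0 < a n" for n using moment_pos[OF False] by (simp add: a_def)
  have "a i * a j \<le> a 0 * a (i + j)"
  proof (induction i)
    case (Suc i)
    have "a i * (a (Suc i) * a j) \<le> a (Suc i) * (a 0 * a (i + j))"
      using mult_left_mono[OF Suc, of "a (Suc i)"] pos[of "Suc i"] by (simp add: algebra_simps)
    also have "\<dots> = a 0 * (a (Suc i) * a (i + j))" by simp
    also have "\<dots> \<le> a 0 * (a i * a (Suc (i + j)))"
      using moment_ratio_mono[OF False, of i j] pos[of 0]
      by (intro mult_left_mono) (auto simp: a_def)
    finally have "a i * (a (Suc i) * a j) \<le> a i * (a 0 * a (Suc i + j))"
      by (simp add: algebra_simps)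
    then show ?case using pos[of i] by (simp add: mult_le_cancel_left_pos)
  qed simp
  then show ?thesis by (simp add: a_def)
qed simp

text \<open>Jensen's inequality for the spectral measure of the unit vector \<open>v\<close>,
  obtained by multiplying moments one at a time.\<close>

lemma power_form_le_moment:
  assumes "norm v = 1"
  shows "(v \<bullet> T v) ^ n \<le> v \<bullet> (T ^^ n) v"
proof (induction n)
  case (Suc n)
  have "(v \<bullet> T v) * (v \<bullet> T v) ^ n \<le> (v \<bullet> T v) * (v \<bullet> (T ^^ n) v)"
    using Suc form_nonneg by (intro mult_left_mono)
  also have "\<dots> \<le> (v \<bullet> v) * (v \<bullet> (T ^^ Suc n) v)" using moment_mult_le[of v 1 n] by simp
  finally show ?case using assms by (simp add: norm_eq_1)
qed (use assms in \<open>simp add: norm_eq_1\<close>)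

lemma moment_odd_lower: "l * (x \<bullet> (T ^^ (2 * n)) x) \<le> x \<bullet> (T ^^ Suc (2 * n)) x"
  using lower[of "(T ^^ n) x"] moment_add[of x n n x] moment_add[of x n "Suc n" x]
  by (simp add: mult_2)

text \<open>The operator inequality \<open>T^2 \<le> T\<close>, evaluated at \<open>T^n x\<close>.
  Cauchy-Schwarz for the form of \<open>T\<close>, applied to \<open>y\<close> and
  \<open>T y\<close>, bounds \<open>|T y|^4\<close> by \<open>(y \<bullet> T y) |T y|^2\<close>, and
  one factor cancels.\<close>

lemma moment_even_upper: "x \<bullet> (T ^^ Suc (Suc (2 * n))) x \<le> x \<bullet> (T ^^ Suc (2 * n)) x"
proof -
  define y where "y = (T ^^ n) x"
  have eq: "x \<bullet> (T ^^ Suc (Suc (2 * n))) x = T y \<bullet> T y" "x \<bullet> (T ^^ Suc (2 * n)) x = y \<bullet> T y"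
    using moment_add[of x "Suc n" "Suc n" x] moment_add[of x n "Suc n" x]
    by (simp_all add: mult_2 y_def)
  have "T y \<bullet> T y \<le> y \<bullet> T y"
  proof (cases "T y = 0")
    case False
    have "(T y \<bullet> T y)\<^sup>2 = (y \<bullet> T (T y))\<^sup>2" by (simp add: self_adjoint)
    also have "\<dots> \<le> (y \<bullet> T y) * (T y \<bullet> T (T y))" by (rule form_Cauchy_Schwarz)
    also have "\<dots> \<le> (y \<bullet> T y) * (T y \<bullet> T y)" by (intro mult_left_mono upper form_nonneg)
    finally have "(T y \<bullet> T y) * (T y \<bullet> T y) \<le> (y \<bullet> T y) * (T y \<bullet> T y)"
      by (simp add: power2_eq_square)
    then show ?thesis using False by (simp add: mult_le_cancel_right)
  qed (simp add: form_nonneg)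
  then show ?thesis by (simp only: eq)
qed

section \<open>Even powers: traces and moments as sums of squares\<close>

lemma trace_even_power: "op_trace (T ^^ (2 * n)) = (\<Sum>b\<in>Basis. ((T ^^ n) b \<bullet> (T ^^ n) b))"
  by (simp add: op_trace_def mult_2 moment_add)

text \<open>This exhibits the even moment as a sum of squares of linear forms in \<open>x\<close>,
  the shape to which a bound on second moments applies.\<close>

lemma even_moment_eq_sum: "x \<bullet> (T ^^ (2 * n)) x = (\<Sum>b\<in>Basis. (x \<bullet> (T ^^ n) b)\<^sup>2)"
proof -
  have "x \<bullet> (T ^^ (2 * n)) x = (T ^^ n) x \<bullet> (T ^^ n) x" by (simp add: mult_2 moment_add)
  also have "\<dots> = (\<Sum>b\<in>Basis. ((T ^^ n) x \<bullet> b) * ((T ^^ n) x \<bullet> b))" by (rule euclidean_inner)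
  finally show ?thesis by (simp add: self_adjoint_power power2_eq_square)
qed

lemma even_moment_le_trace:
  assumes "norm v = 1"
  shows "v \<bullet> (T ^^ (2 * n)) v \<le> op_trace (T ^^ (2 * n))"
  unfolding even_moment_eq_sum trace_even_power
proof (rule sum_mono)
  fix b :: 'a
  show "(v \<bullet> (T ^^ n) b)\<^sup>2 \<le> (T ^^ n) b \<bullet> (T ^^ n) b"
    using Cauchy_Schwarz_ineq[of v "(T ^^ n) b"] assms by (simp add: norm_eq_1)
qed

lemma trace_power_ge:
  assumes "norm v = 1"
  shows "(v \<bullet> T v) ^ (2 * n) \<le> op_trace (T ^^ (2 * n))"
  using power_form_le_moment[OF assms] even_moment_le_trace[OF assms] order_trans by blast

end

section \<open>Trace of a power under a rank-one perturbation\<close>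

definition rank_one_diff :: "('a::euclidean_space \<Rightarrow> 'a) \<Rightarrow> real \<Rightarrow> 'a \<Rightarrow> 'a \<Rightarrow> 'a" where
  "rank_one_diff T \<tau> x = (\<lambda>y. T y - (\<tau> * (x \<bullet> y)) *\<^sub>R x)"

lemma linear_rank_one_diff: "linear T \<Longrightarrow> linear (rank_one_diff T \<tau> x)"
  by (rule linearI)
    (simp_all add: rank_one_diff_def linear_add linear_cmul inner_add_right algebra_simps)

text \<open>Product rule for noncommuting factors: differentiating the factor with \<open>i\<close>
  copies of the operator to its left contributes \<open>- A^i x x^T A^(n-1-i)\<close>.\<close>

lemma rank_one_diff_power_derivative:
  fixes T :: "'a::euclidean_space \<Rightarrow> 'a" and x :: 'a
  assumes T: "linear T"
  defines "A \<equiv> \<lambda>\<tau>. rank_one_diff T \<tau> x"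
  shows "((\<lambda>\<tau>. (A \<tau> ^^ n) y) has_vector_derivative
            - (\<Sum>i<n. (x \<bullet> (A \<tau> ^^ (n - 1 - i)) y) *\<^sub>R (A \<tau> ^^ i) x)) (at \<tau>)"
proof (induction n)
  case 0
  then show ?case by simp
next
  case (Suc n)
  define f where "f = (\<lambda>\<tau>. (A \<tau> ^^ n) y)"
  define f' where "f' = - (\<Sum>i<n. (x \<bullet> (A \<tau> ^^ (n - 1 - i)) y) *\<^sub>R (A \<tau> ^^ i) x)"
  have f: "(f has_vector_derivative f') (at \<tau>)" using Suc unfolding f_def f'_def .
  have Tf: "((\<lambda>\<tau>. T (f \<tau>)) has_vector_derivative T f') (at \<tau>)"
    by (rule bounded_linear.has_vector_derivative[OF T[unfolded linear_conv_bounded_linear] f])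
  have "((\<lambda>\<tau>. x \<bullet> f \<tau>) has_real_derivative x \<bullet> f') (at \<tau>)"
    using bounded_linear.has_vector_derivative[OF bounded_linear_inner_right f]
    by (simp add: has_real_derivative_iff_has_vector_derivative)
  then have "((\<lambda>\<tau>. \<tau> * (x \<bullet> f \<tau>)) has_real_derivative 1 * (x \<bullet> f \<tau>) + \<tau> * (x \<bullet> f')) (at \<tau>)"
    by (auto intro!: derivative_eq_intros)
  from has_vector_derivative_scaleR[OF this has_vector_derivative_const[of x]]
  have "((\<lambda>\<tau>. (\<tau> * (x \<bullet> f \<tau>)) *\<^sub>R x) has_vector_derivative (1 * (x \<bullet> f \<tau>) + \<tau> * (x \<bullet> f')) *\<^sub>R x) (at \<tau>)"
    by (simp add: add.commute)
  from has_vector_derivative_diff[OF Tf this]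
  have "((\<lambda>\<tau>. T (f \<tau>) - (\<tau> * (x \<bullet> f \<tau>)) *\<^sub>R x) has_vector_derivative
          T f' - (1 * (x \<bullet> f \<tau>) + \<tau> * (x \<bullet> f')) *\<^sub>R x) (at \<tau>)"
    .
  also have "T f' - (1 * (x \<bullet> f \<tau>) + \<tau> * (x \<bullet> f')) *\<^sub>R x = A \<tau> f' - (x \<bullet> f \<tau>) *\<^sub>R x"
    by (simp add: A_def rank_one_diff_def algebra_simps)
  also have "A \<tau> f' = - (\<Sum>i<n. (x \<bullet> (A \<tau> ^^ (n - 1 - i)) y) *\<^sub>R (A \<tau> ^^ Suc i) x)"
    using linear_rank_one_diff[OF T]
    by (simp add: f'_def A_def linear_neg linear_sum linear_cmul)
  also have "\<dots> - (x \<bullet> f \<tau>) *\<^sub>R x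
      = - (\<Sum>i<Suc n. (x \<bullet> (A \<tau> ^^ (Suc n - 1 - i)) y) *\<^sub>R (A \<tau> ^^ i) x)"
    unfolding sum.lessThan_Suc_shift by (simp add: f_def)
  finally show ?case by (simp add: f_def A_def rank_one_diff_def)
qed

lemma rank_one_diff_inner_derivative:
  fixes T :: "'a::euclidean_space \<Rightarrow> 'a" and x :: 'a
  assumes "linear T"
  defines "A \<equiv> \<lambda>\<tau>. rank_one_diff T \<tau> x"
  shows "((\<lambda>\<tau>. z \<bullet> (A \<tau> ^^ n) y) has_real_derivative
            - (\<Sum>i<n. (x \<bullet> (A \<tau> ^^ (n - 1 - i)) y) * (z \<bullet> (A \<tau> ^^ i) x))) (at \<tau>)"
  using bounded_linear.has_vector_derivative[OF bounded_linear_inner_right[of z]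
      rank_one_diff_power_derivative[OF assms(1), where x = x and n = n and y = y and \<tau> = \<tau>]]
  by (simp add: has_real_derivative_iff_has_vector_derivative A_def inner_sum_right)

text \<open>Self-adjointness does the work of cyclicity: moving the powers onto \<open>x\<close> and
  summing over the basis turns each of the \<open>n\<close> terms into the same moment of order
  \<open>n - 1\<close>.\<close>

lemma rank_one_diff_trace_derivative:
  fixes T :: "'a::euclidean_space \<Rightarrow> 'a" and x :: 'a
  defines "A \<equiv> \<lambda>\<tau>. rank_one_diff T \<tau> x"
  assumes T: "linear T" and A: "pos_contraction (A \<tau>) l"
  shows "((\<lambda>\<tau>. op_trace (A \<tau> ^^ n)) has_real_derivative
            - (real n * (x \<bullet> (A \<tau> ^^ (n - 1)) x))) (at \<tau>)"
proof -
  interpret pos_contraction "A \<tau>" l by (rule A)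
  have "((\<lambda>\<tau>. op_trace (A \<tau> ^^ n)) has_real_derivative
      (\<Sum>b\<in>Basis. - (\<Sum>i<n. (x \<bullet> (A \<tau> ^^ (n - 1 - i)) b) * (b \<bullet> (A \<tau> ^^ i) x)))) (at \<tau>)"
    unfolding op_trace_def A_def by (intro DERIV_sum rank_one_diff_inner_derivative T)
  also have "(\<Sum>b\<in>Basis. - (\<Sum>i<n. (x \<bullet> (A \<tau> ^^ (n - 1 - i)) b) * (b \<bullet> (A \<tau> ^^ i) x)))
      = - (\<Sum>i<n. \<Sum>b\<in>Basis. ((A \<tau> ^^ (n - 1 - i)) x \<bullet> b) * ((A \<tau> ^^ i) x \<bullet> b))"
    by (subst sum.swap) (simp add: sum_negf self_adjoint_power[of x] inner_commute)
  also have "\<dots> = - (\<Sum>i<n. x \<bullet> (A \<tau> ^^ (n - 1)) x)"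
    by (intro arg_cong[where f = uminus] sum.cong refl)
      (simp add: euclidean_inner[symmetric] moment_add[symmetric])
  finally show ?thesis by simp
qed

text \<open>The derivative of the trace along the path is \<open>- 2 n g\<close>, where
  \<open>g\<close> is an odd moment. The product inequality for moments prevents \<open>g\<close>
  from decaying faster than an exponential, and integration gives the bound. For
  \<open>e = s / (2 * n)\<close> the coefficient is \<open>(1 - exp (- K s)) / K\<close>, with no
  explicit dependence on \<open>n\<close>.\<close>

lemma trace_power_rank_one_diff_le:
  fixes T :: "'a::euclidean_space \<Rightarrow> 'a" and x :: 'a
  assumes T: "pos_contraction T l" and T': "pos_contraction (rank_one_diff T e x) l"
    and e: "0 \<le> e" and x: "x \<bullet> x \<le> l * K" and K: "0 < K" and n: "0 < n"
  shows "op_trace (rank_one_diff T e x ^^ (2 * n))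
    \<le> op_trace (T ^^ (2 * n)) - (1 - exp (- (real (2 * n) * K * e))) / K * (x \<bullet> (T ^^ (2 * n)) x)"
proof -
  define A where "A = (\<lambda>\<tau>. rank_one_diff T \<tau> x)"
  obtain k where k: "n = Suc k" using n by (cases n) auto
  interpret T: pos_contraction T l by (rule T)
  interpret T': pos_contraction "rank_one_diff T e x" l by (rule T')
  have A0: "A 0 = T" by (simp add: A_def rank_one_diff_def)
  \<comment> \<open>The form of \<open>A \<tau>\<close> decreases in \<tau>, so it inherits the
    lower bound from the end point \<open>e\<close> and the upper bound from 0.\<close>
  have A: "pos_contraction (A \<tau>) l" if "0 \<le> \<tau>" "\<tau> \<le> e" for \<tau>
  proof (rule pos_contraction.intro)
    show "linear (A \<tau>)" unfolding A_def by (rule linear_rank_one_diff[OF T.linear])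
    show "y \<bullet> A \<tau> z = A \<tau> y \<bullet> z" for y z
      using T.self_adjoint[of y z]
      by (simp add: A_def rank_one_diff_def inner_diff_left inner_diff_right inner_commute)
    show "0 < l" by (rule T.l_pos)
    have form: "y \<bullet> A \<tau> y = y \<bullet> T y - \<tau> * (x \<bullet> y)\<^sup>2" for \<tau> y
      by (simp add: A_def rank_one_diff_def inner_diff_right inner_commute power2_eq_square)
    show "l * (y \<bullet> y) \<le> y \<bullet> A \<tau> y" for y
    proof -
      have "l * (y \<bullet> y) \<le> y \<bullet> A e y" using T'.lower[of y] by (simp add: A_def)
      also have "\<dots> \<le> y \<bullet> A \<tau> y" using that by (simp add: form mult_right_mono)
      finally show ?thesis .
    qed
    show "y \<bullet> A \<tau> y \<le> y \<bullet> y" for y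
      using T.upper[of y] that by (simp add: form add_increasing2 diff_le_eq)
  qed
  \<comment> \<open>The order is \<open>2 * n - 1\<close>, hence odd:
    \<open>moment_odd_lower\<close> controls the moment of order \<open>2 * k\<close> by this one at
    the cost of the factor \<open>l\<close>, which the hypothesis on \<open>x \<bullet> x\<close>
    compensates.\<close>
  define g where "g = (\<lambda>\<tau>. x \<bullet> (A \<tau> ^^ (2 * k + 1)) x)"
  define g' where "g' = (\<lambda>\<tau>. - (\<Sum>i<2 * k + 1. (x \<bullet> (A \<tau> ^^ (2 * k - i)) x) * (x \<bullet> (A \<tau> ^^ i) x)))"
  define C where "C = real (2 * n) * K"
  have g_deriv: "(g has_real_derivative g' \<tau>) (at \<tau>)" for \<tau>
    using rank_one_diff_inner_derivative[OF T.linear, where x = x and z = x and n = "2 * k + 1" and y = x and \<tau> = \<tau>]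
    by (simp add: g_def g'_def A_def)
  have g'_ge: "- (C * g \<tau>) \<le> g' \<tau>" if \<tau>: "0 \<le> \<tau>" "\<tau> \<le> e" for \<tau>
  proof -
    interpret A: pos_contraction "A \<tau>" l by (rule A[OF \<tau>])
    have "(x \<bullet> (A \<tau> ^^ (2 * k - i)) x) * (x \<bullet> (A \<tau> ^^ i) x) \<le> K * g \<tau>" if i: "i < 2 * k + 1" for i
    proof -
      have nonneg: "0 \<le> x \<bullet> (A \<tau> ^^ (2 * k)) x"
        using A.moment_pos[of x "2 * k"] by (cases "x = 0") auto
      have "(x \<bullet> (A \<tau> ^^ (2 * k - i)) x) * (x \<bullet> (A \<tau> ^^ i) x) \<le> (x \<bullet> x) * (x \<bullet> (A \<tau> ^^ (2 * k)) x)"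
        using A.moment_mult_le[of x "2 * k - i" i] i by simp
      also have "\<dots> \<le> (l * K) * (x \<bullet> (A \<tau> ^^ (2 * k)) x)" using x nonneg by (intro mult_right_mono)
      also have "\<dots> = K * (l * (x \<bullet> (A \<tau> ^^ (2 * k)) x))" by simp
      also have "\<dots> \<le> K * g \<tau>" using K A.moment_odd_lower[of x k] by (simp add: g_def)
      finally show ?thesis .
    qed
    then have "(\<Sum>i<2 * k + 1. (x \<bullet> (A \<tau> ^^ (2 * k - i)) x) * (x \<bullet> (A \<tau> ^^ i) x))
        \<le> (\<Sum>i<2 * k + 1. K * g \<tau>)" by (intro sum_mono) auto
    also have "\<dots> = (2 * real k + 1) * (K * g \<tau>)" by simp
    \<comment> \<open>The sum has \<open>2 * n - 1\<close> terms; rounding up to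
      \<open>2 * n\<close> yields the constant \<open>C\<close>.\<close>
    also have "\<dots> \<le> (2 * real n) * (K * g \<tau>)"
    proof (rule mult_right_mono)
      show "0 \<le> K * g \<tau>"
        using K A.moment_pos[of x "2 * k + 1"] by (cases "x = 0") (auto simp: g_def)
    qed (simp add: k)
    finally show ?thesis by (simp add: g'_def C_def)
  qed
  have g_ge: "exp (- (C * \<tau>)) * g 0 \<le> g \<tau>" if \<tau>: "0 \<le> \<tau>" "\<tau> \<le> e" for \<tau>
  proof -
    \<comment> \<open>Integrating factor for the differential inequality
      \<open>g' \<ge> - C g\<close>.\<close>
    have "exp (C * 0) * g 0 \<le> exp (C * \<tau>) * g \<tau>"
    proof (rule DERIV_nonneg_imp_nondecreasing[OF \<tau>(1)])
      fix u assume u: "0 \<le> u" "u \<le> \<tau>"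
      have "((\<lambda>u. exp (C * u) * g u) has_real_derivative exp (C * u) * (C * g u + g' u)) (at u)"
        by (auto intro!: derivative_eq_intros g_deriv simp: algebra_simps)
      moreover have "0 \<le> exp (C * u) * (C * g u + g' u)" using g'_ge[of u] u \<tau> by simp
      ultimately show "\<exists>y. ((\<lambda>u. exp (C * u) * g u) has_real_derivative y) (at u) \<and> 0 \<le> y" by blast
    qed
    then have "exp (- (C * \<tau>)) * g 0 \<le> exp (- (C * \<tau>)) * (exp (C * \<tau>) * g \<tau>)" by simp
    also have "\<dots> = g \<tau>" by (simp add: exp_minus)
    finally show ?thesis .
  qed
  \<comment> \<open>Since \<open>C / K = 2 n\<close>, the added term has derivative
    \<open>2 n exp (- C \<tau>) g 0\<close>, exactly the rate of decrease of the trace that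
    \<open>g_ge\<close> guarantees.\<close>
  define G where "G = (\<lambda>\<tau>. op_trace (A \<tau> ^^ (2 * n)) + (1 - exp (- (C * \<tau>))) / K * g 0)"
  have "G e \<le> G 0"
  proof (rule DERIV_nonpos_imp_nonincreasing[OF e])
    fix \<tau> assume \<tau>: "0 \<le> \<tau>" "\<tau> \<le> e"
    have "((\<lambda>\<tau>. op_trace (A \<tau> ^^ (2 * n))) has_real_derivative - (real (2 * n) * g \<tau>)) (at \<tau>)"
      using rank_one_diff_trace_derivative[OF T.linear A[OF \<tau>, unfolded A_def], where n = "2 * n"]
      by (simp add: g_def k A_def)
    moreover have "((\<lambda>\<tau>. (1 - exp (- (C * \<tau>))) / K * g 0) has_real_derivative
        real (2 * n) * (exp (- (C * \<tau>)) * g 0)) (at \<tau>)"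
      using K by (auto intro!: derivative_eq_intros simp: C_def)
    ultimately have "(G has_real_derivative
        - (real (2 * n) * g \<tau>) + real (2 * n) * (exp (- (C * \<tau>)) * g 0)) (at \<tau>)"
      unfolding G_def by (rule DERIV_add)
    moreover have "- (real (2 * n) * g \<tau>) + real (2 * n) * (exp (- (C * \<tau>)) * g 0) \<le> 0"
      using mult_left_mono[OF g_ge[OF \<tau>], of "real (2 * n)"] by simp
    ultimately show "\<exists>y. (G has_real_derivative y) (at \<tau>) \<and> y \<le> 0" by blast
  qed
  moreover have "(1 - exp (- (C * e))) / K * (x \<bullet> (T ^^ (2 * n)) x) \<le> (1 - exp (- (C * e))) / K * g 0"
  proof (rule mult_left_mono)
    show "x \<bullet> (T ^^ (2 * n)) x \<le> g 0" using T.moment_even_upper[of x k] by (simp add: g_def k A0)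
    show "0 \<le> (1 - exp (- (C * e))) / K" using K e by (simp add: C_def)
  qed
  ultimately show ?thesis by (simp add: G_def A0 A_def[symmetric] C_def) (simp add: A_def)
qed

section \<open>A lower tail bound for sums of random rank-one operators\<close>

definition gram_op :: "real \<Rightarrow> 'i set \<Rightarrow> ('i \<Rightarrow> 'a::euclidean_space) \<Rightarrow> 'a \<Rightarrow> 'a" where
  "gram_op e J z = (\<lambda>y. y - e *\<^sub>R (\<Sum>i\<in>J. (z i \<bullet> y) *\<^sub>R z i))"

lemma gram_op_insert:
  assumes "finite J" "i \<notin> J"
  shows "gram_op e (insert i J) (z(i := y)) = rank_one_diff (gram_op e J z) e y"
proof -
  have "(\<Sum>j\<in>J. (if j = i then y \<bullet> w else z j \<bullet> w) *\<^sub>R (if j = i then y else z j)) = (\<Sum>j\<in>J. (z j \<bullet> w) *\<^sub>R z j)" for w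
    using assms by (intro sum.cong) auto
  then show ?thesis using assms
    by (auto simp: gram_op_def rank_one_diff_def fun_eq_iff algebra_simps if_distrib cong: if_cong)
qed

lemma gram_op_form: "y \<bullet> gram_op e J z y = y \<bullet> y - e * (\<Sum>i\<in>J. (z i \<bullet> y)\<^sup>2)"
  by (simp add: gram_op_def inner_diff_right inner_sum_right inner_commute power2_eq_square)

lemma pos_contraction_gram_op:
  assumes "0 \<le> e" "0 < l" "\<And>i. i \<in> J \<Longrightarrow> z i \<bullet> z i \<le> R" "e * (real (card J) * R) \<le> 1 - l"
  shows "pos_contraction (gram_op e J z) l"
proof (rule pos_contraction.intro)
  show "linear (gram_op e J z)"
    by (rule linearI) (simp_all add: gram_op_def inner_add_right scaleR_add_left sum.distrib distrib_left
        scaleR_add_right scaleR_diff_right scaleR_sum_right mult_ac)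
  show "x \<bullet> gram_op e J z y = gram_op e J z x \<bullet> y" for x y
    by (simp add: gram_op_def inner_diff_right inner_diff_left inner_sum_right inner_sum_left
        inner_commute mult_ac)
  show "0 < l" by fact
  show "y \<bullet> gram_op e J z y \<le> y \<bullet> y" for y
    using assms(1) by (simp add: gram_op_form sum_nonneg)
  show "l * (y \<bullet> y) \<le> y \<bullet> gram_op e J z y" for y
  proof -
    have "(\<Sum>i\<in>J. (z i \<bullet> y)\<^sup>2) \<le> (\<Sum>i\<in>J. R * (y \<bullet> y))"
    proof (rule sum_mono)
      fix i assume "i \<in> J"
      then have "(z i \<bullet> z i) * (y \<bullet> y) \<le> R * (y \<bullet> y)" using assms(3) by (intro mult_right_mono) auto
      then show "(z i \<bullet> y)\<^sup>2 \<le> R * (y \<bullet> y)" using Cauchy_Schwarz_ineq order_trans by blast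
    qed
    then have "e * (\<Sum>i\<in>J. (z i \<bullet> y)\<^sup>2) \<le> e * (real (card J) * R) * (y \<bullet> y)"
      using assms(1) by (simp add: mult_left_mono mult.assoc)
    also have "\<dots> \<le> (1 - l) * (y \<bullet> y)" using assms(4) by (intro mult_right_mono) auto
    finally show ?thesis by (simp add: gram_op_form algebra_simps)
  qed
qed

section \<open>Expected trace over independent vectors\<close>

lemma measurable_gram_op_power:
  assumes "\<And>i. sets (D i) = sets borel" "J \<subseteq> I"
  shows "(\<lambda>z. (gram_op e J z ^^ n) (y::'a::euclidean_space)) \<in> borel_measurable (PiM I D)"
proof (induction n)
  case (Suc n)
  have [measurable]: "(\<lambda>z. z i) \<in> borel_measurable (PiM I D)" if "i \<in> J" for i
    using measurable_component_singleton[of i I D] that assms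
    by (auto cong: measurable_cong_sets)
  note Suc[measurable]
  show ?case by (simp add: gram_op_def[of e J, THEN fun_cong, of _ "(gram_op e J _ ^^ n) y"])
qed simp

lemma (in prob_space) integrable_inner_square:
  fixes X :: "'a \<Rightarrow> 'b::euclidean_space"
  assumes [measurable]: "X \<in> borel_measurable M" and bounded: "AE \<omega> in M. X \<omega> \<bullet> X \<omega> \<le> R"
  shows "integrable M (\<lambda>\<omega>. (X \<omega> \<bullet> y)\<^sup>2)"
proof (rule integrable_const_bound)
  show "AE \<omega> in M. norm ((X \<omega> \<bullet> y)\<^sup>2) \<le> R * (y \<bullet> y)"
    using bounded
  proof eventually_elim
    case (elim \<omega>)
    then have "(X \<omega> \<bullet> X \<omega>) * (y \<bullet> y) \<le> R * (y \<bullet> y)" by (intro mult_right_mono) auto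
    then show ?case using Cauchy_Schwarz_ineq[of "X \<omega>" y] by simp
  qed
qed simp

text \<open>With the other vectors fixed, the rank-one bound is linear in \<open>y y^T\<close>, so
  averaging over the new vector loses at least \<open>c * \<kappa>\<close> times the current trace.
  Each vector contributes a factor \<open>1 - c * \<kappa>\<close>, starting from the trace of the
  identity.\<close>

lemma expected_trace_gram_op_power_le:
  fixes D :: "'i \<Rightarrow> 'a::euclidean_space measure"
  assumes prob: "\<And>i. prob_space (D i)" and sets: "\<And>i. sets (D i) = sets borel"
    and bounded: "\<And>i. AE x in D i. x \<bullet> x \<le> R"
    and second_moment: "\<And>i y. \<kappa> * (y \<bullet> y) \<le> (\<integral>x. (x \<bullet> y)\<^sup>2 \<partial>D i)"
    and e: "0 \<le> e" and l: "0 < l" and R: "0 < R" and \<kappa>: "\<kappa> \<le> R" and n: "0 < n"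
  defines "c \<equiv> (1 - exp (- (real (2 * n) * (R / l) * e))) / (R / l)"
  assumes J: "finite J" "e * (real (card J) * R) \<le> 1 - l"
  shows "(\<integral>\<^sup>+z. ennreal (op_trace (gram_op e J z ^^ (2 * n))) \<partial>PiM J D)
    \<le> ennreal (real DIM('a) * (1 - c * \<kappa>) ^ card J)"
  using J
proof (induction J)
  case empty
  interpret product_prob_space D by (intro product_prob_spaceI prob)
  have id: "(gram_op e {} (z::'i \<Rightarrow> 'a) ^^ k) y = y" for z k y
    by (induction k) (simp_all add: gram_op_def)
  have "op_trace (gram_op e {} (z::'i \<Rightarrow> 'a) ^^ (2 * n)) = real DIM('a)" for z
    by (simp add: op_trace_def id)
  then show ?case by (simp add: emeasure_space_1 PiM_empty)
next
  case (insert i J)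
  interpret Di: prob_space "D i" by (rule prob)
  interpret product_prob_space D by (intro product_prob_spaceI prob)
  \<comment> \<open>These bounds make \<open>1 - c * \<kappa>\<close> nonnegative, as
    multiplicativity of \<open>ennreal\<close> requires.\<close>
  have cK: "0 \<le> c" "c * R \<le> 1"
  proof -
    have "0 \<le> real (2 * n) * (R / l) * e" using e l R by simp
    then have E: "0 \<le> 1 - exp (- (real (2 * n) * (R / l) * e))" "1 - exp (- (real (2 * n) * (R / l) * e)) \<le> 1"
      by simp_all
    then show "0 \<le> c" using l R by (simp add: c_def)
    have "0 \<le> e * (real (card (insert i J)) * R)" using e R by simp
    then have "l \<le> 1" using insert.prems by linarith
    have "c * R = (1 - exp (- (real (2 * n) * (R / l) * e))) * l" using R by (simp add: c_def)
    also have "\<dots> \<le> 1 * 1" using E l \<open>l \<le> 1\<close> by (intro mult_mono) auto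
    finally show "c * R \<le> 1" by simp
  qed
  have c\<kappa>: "0 \<le> 1 - c * \<kappa>" using mult_left_mono[OF \<kappa> cK(1)] cK(2) by simp
  have "e * (real (card J) * R) \<le> e * (real (card (insert i J)) * R)"
    using e R insert.hyps by (intro mult_left_mono mult_right_mono) auto
  then have eJ: "e * (real (card J) * R) \<le> 1 - l" using insert.prems by linarith
  have meas: "(\<lambda>z. op_trace (gram_op e J' z ^^ k)) \<in> borel_measurable (PiM J' D)" for J' :: "'i set" and k
    unfolding op_trace_def by (intro borel_measurable_sum borel_measurable_inner measurable_gram_op_power sets) auto
  have step: "(\<integral>\<^sup>+y. ennreal (op_trace (gram_op e (insert i J) (z(i := y)) ^^ (2 * n))) \<partial>D i)
      \<le> ennreal (1 - c * \<kappa>) * ennreal (op_trace (gram_op e J z ^^ (2 * n)))"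
    if z: "\<And>j. j \<in> J \<Longrightarrow> z j \<bullet> z j \<le> R" for z :: "'i \<Rightarrow> 'a"
  proof -
    define T where "T = gram_op e J z"
    interpret T: pos_contraction T l
      unfolding T_def by (rule pos_contraction_gram_op[OF e l z eJ])
    define h where "h = (\<lambda>y. op_trace (T ^^ (2 * n)) - c * (\<Sum>b\<in>Basis. (y \<bullet> (T ^^ n) b)\<^sup>2))"
    have [measurable]: "(\<lambda>y. y) \<in> borel_measurable (D i)" by (simp add: sets cong: measurable_cong_sets)
    have h: "0 \<le> op_trace (gram_op e (insert i J) (z(i := y)) ^^ (2 * n)) \<and>
        op_trace (gram_op e (insert i J) (z(i := y)) ^^ (2 * n)) \<le> h y" if y: "y \<bullet> y \<le> R" for y
    proof -
      have T': "pos_contraction (gram_op e (insert i J) (z(i := y))) l"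
        using z y insert.hyps insert.prems by (intro pos_contraction_gram_op[OF e l, where R = R]) auto
      show ?thesis
        using trace_power_rank_one_diff_le[OF T.pos_contraction_axioms, of e y "R / l" n] T' e y l R n insert.hyps
        unfolding h_def T_def[symmetric] gram_op_insert[OF insert.hyps(1,2)] T.even_moment_eq_sum[symmetric] c_def
        by (auto simp: pos_contraction.trace_even_power sum_nonneg)
    qed
    have int: "integrable (D i) (\<lambda>y. (y \<bullet> w)\<^sup>2)" for w
      by (rule Di.integrable_inner_square[OF _ bounded]) simp
    then have int_h: "integrable (D i) h" unfolding h_def by auto
    have "(\<integral>\<^sup>+y. ennreal (op_trace (gram_op e (insert i J) (z(i := y)) ^^ (2 * n))) \<partial>D i)
        \<le> (\<integral>\<^sup>+y. ennreal (h y) \<partial>D i)"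
      using bounded[of i] by (intro nn_integral_mono_AE) (auto elim!: eventually_mono intro!: ennreal_leI dest!: h)
    also have "\<dots> = ennreal (\<integral>y. h y \<partial>D i)"
      using bounded[of i] by (intro nn_integral_eq_integral int_h) (auto elim!: eventually_mono dest!: h)
    also have "(\<integral>y. h y \<partial>D i) = op_trace (T ^^ (2 * n)) - c * (\<Sum>b\<in>Basis. \<integral>y. (y \<bullet> (T ^^ n) b)\<^sup>2 \<partial>D i)"
      using int by (simp add: h_def Di.prob_space)
    also have "\<dots> \<le> op_trace (T ^^ (2 * n)) - c * (\<Sum>b\<in>Basis. \<kappa> * ((T ^^ n) b \<bullet> (T ^^ n) b))"
      using cK(1) by (intro diff_left_mono mult_left_mono sum_mono second_moment)
    also have "\<dots> = (1 - c * \<kappa>) * op_trace (T ^^ (2 * n))"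
      by (simp add: T.trace_even_power sum_distrib_left[symmetric] left_diff_distrib)
    finally show ?thesis
      unfolding T_def ennreal_mult'[OF c\<kappa>] by (simp add: ennreal_leI del: fun_upd_apply)
  qed
  have AE_bounded: "AE z in PiM J D. \<forall>j\<in>J. z j \<bullet> z j \<le> R"
    using insert.hyps(1) by (intro AE_finite_allI AE_PiM_component prob bounded)
  have "(\<integral>\<^sup>+z. ennreal (op_trace (gram_op e (insert i J) z ^^ (2 * n))) \<partial>PiM (insert i J) D)
      = (\<integral>\<^sup>+z. \<integral>\<^sup>+y. ennreal (op_trace (gram_op e (insert i J) (z(i := y)) ^^ (2 * n))) \<partial>D i \<partial>PiM J D)"
    using meas by (intro product_nn_integral_insert insert.hyps) measurable
  also have "\<dots> \<le> (\<integral>\<^sup>+z. ennreal (1 - c * \<kappa>) * ennreal (op_trace (gram_op e J z ^^ (2 * n))) \<partial>PiM J D)"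
    using AE_bounded by (intro nn_integral_mono_AE) (auto elim!: eventually_mono intro!: step)
  also have "\<dots> = ennreal (1 - c * \<kappa>) * (\<integral>\<^sup>+z. ennreal (op_trace (gram_op e J z ^^ (2 * n))) \<partial>PiM J D)"
    using meas by (intro nn_integral_cmult) measurable
  also have "\<dots> \<le> ennreal (1 - c * \<kappa>) * ennreal (real DIM('a) * (1 - c * \<kappa>) ^ card J)"
    using insert.IH[OF eJ] by (intro mult_left_mono) auto
  also have "\<dots> = ennreal (real DIM('a) * (1 - c * \<kappa>) ^ card (insert i J))"
    using insert.hyps c\<kappa> by (simp add: ennreal_mult'[symmetric] mult_ac)
  finally show ?case .
qed

text \<open>Markov's inequality for the trace. Taking for \<open>A\<close> any event on which almost
  surely some unit vector has a small form keeps measurability of the least eigenvalue out of the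
  argument.\<close>

lemma (in prob_space) gram_lower_tail_finite:
  fixes X :: "'i \<Rightarrow> 'a \<Rightarrow> 'b::euclidean_space"
  assumes I: "finite I" "I \<noteq> {}" and indep: "indep_vars (\<lambda>_. borel) X I"
    and bounded: "\<And>i. i \<in> I \<Longrightarrow> AE \<omega> in M. X i \<omega> \<bullet> X i \<omega> \<le> R"
    and second_moment: "\<And>i y. i \<in> I \<Longrightarrow> \<kappa> * (y \<bullet> y) \<le> expectation (\<lambda>\<omega>. (X i \<omega> \<bullet> y)\<^sup>2)"
    and R: "0 < R" and \<kappa>: "\<kappa> \<le> R"
    and e: "0 \<le> e" and l: "0 < l" "e * (real (card I) * R) \<le> 1 - l" and n: "0 < n"
    and A: "A \<in> events" and \<tau>: "e * \<tau> \<le> 1"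
    and small: "AE \<omega> in M. \<omega> \<in> A \<longrightarrow> (\<exists>v. norm v = 1 \<and> (\<Sum>i\<in>I. (X i \<omega> \<bullet> v)\<^sup>2) \<le> \<tau>)"
  defines "c \<equiv> (1 - exp (- (real (2 * n) * (R / l) * e))) / (R / l)"
  shows "prob A * (1 - e * \<tau>) ^ (2 * n) \<le> real DIM('b) * (1 - c * \<kappa>) ^ card I"
proof -
  obtain i0 where i0: "i0 \<in> I" using I by blast
  \<comment> \<open>Outside \<open>I\<close> the law of \<open>X i0\<close> serves as filler, so
    that the hypotheses of the expectation bound hold for every index.\<close>
  define D where "D = (\<lambda>i. distr M borel (X (if i \<in> I then i else i0)))"
  have rv: "X i \<in> borel_measurable M" if "i \<in> I" for i
    using indep that by (simp add: indep_vars_def)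
  have rv': "X (if i \<in> I then i else i0) \<in> borel_measurable M" for i using rv i0 by simp
  define tr where "tr = (\<lambda>z :: 'i \<Rightarrow> 'b. op_trace (gram_op e I z ^^ (2 * n)))"
  have "(\<integral>\<^sup>+z. ennreal (tr z) \<partial>PiM I D) \<le> ennreal (real DIM('b) * (1 - c * \<kappa>) ^ card I)"
    unfolding tr_def c_def
  proof (rule expected_trace_gram_op_power_le[OF _ _ _ _ e l(1) R \<kappa> n I(1) l(2)])
    fix i
    show "prob_space (D i)" "sets (D i) = sets borel" using rv' by (auto simp: D_def prob_space_distr)
    show "AE x in D i. x \<bullet> x \<le> R"
      unfolding D_def using bounded i0 by (subst AE_distr_iff[OF rv']) auto
    show "\<kappa> * (y \<bullet> y) \<le> (\<integral>x. (x \<bullet> y)\<^sup>2 \<partial>D i)" for y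
      unfolding D_def using second_moment i0 by (subst integral_distr[OF rv']) auto
  qed
  also have "PiM I D = distr M (PiM I (\<lambda>_. borel)) (\<lambda>\<omega>. \<lambda>i\<in>I. X i \<omega>)"
    using indep indep_vars_iff_distr_eq_PiM'[OF I(2), of X "\<lambda>_. borel"] rv
    by (auto simp: D_def cong: PiM_cong)
  also have "(\<integral>\<^sup>+z. ennreal (tr z) \<partial>\<dots>) = (\<integral>\<^sup>+\<omega>. ennreal (tr (\<lambda>i\<in>I. X i \<omega>)) \<partial>M)"
  proof (rule nn_integral_distr)
    show "(\<lambda>\<omega>. \<lambda>i\<in>I. X i \<omega>) \<in> measurable M (PiM I (\<lambda>_. borel))"
      using rv by (intro measurable_restrict)
    have "tr \<in> borel_measurable (PiM I (\<lambda>_. borel))"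
      unfolding tr_def op_trace_def
      by (intro borel_measurable_sum borel_measurable_inner measurable_gram_op_power) auto
    then show "(\<lambda>z. ennreal (tr z)) \<in> borel_measurable (distr M (PiM I (\<lambda>_. borel)) (\<lambda>\<omega>. \<lambda>i\<in>I. X i \<omega>))"
      by simp
  qed
  finally have upper: "(\<integral>\<^sup>+\<omega>. ennreal (tr (\<lambda>i\<in>I. X i \<omega>)) \<partial>M)
      \<le> ennreal (real DIM('b) * (1 - c * \<kappa>) ^ card I)" .
  have "AE \<omega> in M. \<forall>i\<in>I. X i \<omega> \<bullet> X i \<omega> \<le> R"
    using I(1) bounded by (intro AE_finite_allI) auto
  with small have "AE \<omega> in M. ennreal ((1 - e * \<tau>) ^ (2 * n)) * indicator A \<omega> \<le> ennreal (tr (\<lambda>i\<in>I. X i \<omega>))"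
  proof eventually_elim
    case (elim \<omega>)
    define z where "z = (\<lambda>i\<in>I. X i \<omega>)"
    interpret pos_contraction "gram_op e I z" l
      using elim(2) by (intro pos_contraction_gram_op[OF e l(1) _ l(2)]) (simp add: z_def)
    show ?case
    proof (cases "\<omega> \<in> A")
      case True
      then obtain v where v: "norm v = 1" "(\<Sum>i\<in>I. (X i \<omega> \<bullet> v)\<^sup>2) \<le> \<tau>" using elim(1) by blast
      have "(\<Sum>i\<in>I. (z i \<bullet> v)\<^sup>2) \<le> \<tau>" using v(2) by (simp add: z_def)
      then have "1 - e * \<tau> \<le> v \<bullet> gram_op e I z v"
        using v(1) e by (simp add: gram_op_form norm_eq_1 mult_left_mono)
      then have "(1 - e * \<tau>) ^ (2 * n) \<le> (v \<bullet> gram_op e I z v) ^ (2 * n)"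
        using \<tau> by (intro power_mono) auto
      also have "\<dots> \<le> tr z" unfolding tr_def by (rule trace_power_ge[OF v(1)])
      finally show ?thesis using True by (simp add: z_def ennreal_leI)
    qed simp
  qed
  then have "(\<integral>\<^sup>+\<omega>. ennreal ((1 - e * \<tau>) ^ (2 * n)) * indicator A \<omega> \<partial>M)
      \<le> (\<integral>\<^sup>+\<omega>. ennreal (tr (\<lambda>i\<in>I. X i \<omega>)) \<partial>M)"
    by (rule nn_integral_mono_AE)
  also note upper
  also have "(\<integral>\<^sup>+\<omega>. ennreal ((1 - e * \<tau>) ^ (2 * n)) * indicator A \<omega> \<partial>M)
      = ennreal (prob A * (1 - e * \<tau>) ^ (2 * n))"
    using A \<tau> by (subst nn_integral_cmult_indicator[OF A])
      (simp_all add: emeasure_eq_measure flip: ennreal_mult mult.commute[of "prob A"])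
  finally have "ennreal (prob A * (1 - e * \<tau>) ^ (2 * n)) \<le> ennreal (real DIM('b) * (1 - c * \<kappa>) ^ card I)" .
  \<comment> \<open>The passage from \<open>ennreal\<close> back to reals is faithful when the
    right-hand side is nonnegative.\<close>
  moreover have "0 \<le> real DIM('b) * (1 - c * \<kappa>) ^ card I"
  proof -
    have "0 \<le> real (2 * n) * (R / l) * e" using e l R by simp
    then have E: "0 \<le> 1 - exp (- (real (2 * n) * (R / l) * e))" "1 - exp (- (real (2 * n) * (R / l) * e)) \<le> 1"
      by simp_all
    then have c: "0 \<le> c" using l R by (simp add: c_def)
    have "0 \<le> e * (real (card I) * R)" using e R by simp
    then have l1: "l \<le> 1" using l(2) by linarith
    have "c * \<kappa> \<le> c * R" using c \<kappa> by (rule mult_left_mono[rotated])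
    also have "\<dots> = (1 - exp (- (real (2 * n) * (R / l) * e))) * l" using R by (simp add: c_def)
    also have "\<dots> \<le> 1 * 1" using E l l1 by (intro mult_mono) auto
    finally show ?thesis by simp
  qed
  ultimately show ?thesis by (simp add: ennreal_le_iff)
qed

text \<open>Both sides vanish at 1, and their difference has derivative \<open>ln u + 1 - u\<close>,
  which is at most 0. This turns the Chernoff exponent into the quadratic one.\<close>

lemma half_square_le_entropy:
  fixes t :: real
  assumes "0 < t" "t \<le> 1"
  shows "(1 - t)\<^sup>2 / 2 \<le> 1 - t + t * ln t"
proof -
  define f where "f = (\<lambda>u::real. 1 - u + u * ln u - (1 - u)\<^sup>2 / 2)"
  have "f 1 \<le> f t"
  proof (rule DERIV_nonpos_imp_nonincreasing[OF assms(2)])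
    fix u assume u: "t \<le> u" "u \<le> 1"
    then have "0 < u" using assms by simp
    then have "(f has_real_derivative ln u + 1 - u) (at u)"
      unfolding f_def by (auto intro!: derivative_eq_intros simp: field_simps)
    moreover have "ln u + 1 - u \<le> 0" using ln_le_minus_one[OF \<open>0 < u\<close>] by simp
    ultimately show "\<exists>y. (f has_real_derivative y) (at u) \<and> y \<le> 0" by blast
  qed
  then show ?thesis by (simp add: f_def)
qed

theorem (in prob_space) gram_Chernoff_lower_tail:
  fixes X :: "'i \<Rightarrow> 'a \<Rightarrow> 'b::euclidean_space"
  assumes I: "finite I" "I \<noteq> {}" and indep: "indep_vars (\<lambda>_. borel) X I"
    and bounded: "\<And>i. i \<in> I \<Longrightarrow> AE \<omega> in M. X i \<omega> \<bullet> X i \<omega> \<le> R"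
    and second_moment: "\<And>i y. i \<in> I \<Longrightarrow> \<kappa> * (y \<bullet> y) \<le> expectation (\<lambda>\<omega>. (X i \<omega> \<bullet> y)\<^sup>2)"
    and R: "0 < R" and \<kappa>: "0 \<le> \<kappa>" "\<kappa> \<le> R" and t: "0 < t" "t \<le> 1"
    and A: "A \<in> events"
    and small: "AE \<omega> in M. \<omega> \<in> A \<longrightarrow>
      (\<exists>v. norm v = 1 \<and> (\<Sum>i\<in>I. (X i \<omega> \<bullet> v)\<^sup>2) \<le> t * (real (card I) * \<kappa>))"
  shows "prob A \<le> real DIM('b) * exp (- (real (card I) * \<kappa> * (1 - t)\<^sup>2 / (2 * R)))"
proof -
  define N where "N = real (card I)"
  define \<tau> where "\<tau> = t * (N * \<kappa>)"
  \<comment> \<open>Minimizer of the limiting exponent: it makes \<open>exp (- R * s) = t\<close>,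
    so that \<open>c n\<close> tends to \<open>(1 - t) / R\<close>.\<close>
  define s where "s = - ln t / R"
  \<comment> \<open>Equality in the spectral condition \<open>e * (N * R) \<le> 1 - l\<close> for
    the step size \<open>e = s / (2 * n)\<close>.\<close>
  define l where "l = (\<lambda>n. 1 - s / real (2 * n) * (N * R))"
  define c where "c = (\<lambda>n. (1 - exp (- (R / l n * s))) / (R / l n))"
  have s: "0 \<le> s" using t R by (simp add: s_def divide_nonpos_pos)
  have l_lim: "l \<longlonglongrightarrow> 1" unfolding l_def by real_asymp
  have bound: "\<forall>\<^sub>F n in sequentially.
      prob A * (1 - s / real (2 * n) * \<tau>) ^ (2 * n) \<le> real DIM('b) * (1 - c n * \<kappa>) ^ card I"
  proof -
    have "(\<lambda>n. s / real (2 * n) * \<tau>) \<longlonglongrightarrow> 0" by real_asymp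
    then have "\<forall>\<^sub>F n in sequentially. s / real (2 * n) * \<tau> < 1" by (rule order_tendstoD) simp
    moreover have "\<forall>\<^sub>F n in sequentially. 0 < l n" by (rule order_tendstoD[OF l_lim]) simp
    ultimately show ?thesis using eventually_gt_at_top[of 0]
    proof eventually_elim
      case (elim n)
      have "0 \<le> s / real (2 * n)" using s by simp
      moreover have "s / real (2 * n) * (real (card I) * R) \<le> 1 - l n" by (simp add: l_def N_def)
      moreover have "real (2 * n) * (R / l n) * (s / real (2 * n)) = R / l n * s" using elim by simp
      ultimately show ?case
        using gram_lower_tail_finite[OF I indep bounded second_moment R \<kappa>(2) _ elim(2) _ elim(3) A
          _ small[folded N_def, folded \<tau>_def], of "s / real (2 * n)"] elim(1)
        by (simp add: c_def)
    qed
  qed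
  have c_lim: "c \<longlonglongrightarrow> (1 - t) / R"
  proof -
    have "c \<longlonglongrightarrow> (1 - exp (- (R / 1 * s))) / (R / 1)"
      unfolding c_def using R by (intro tendsto_intros l_lim) auto
    moreover have "exp (- (R / 1 * s)) = t" using t R by (simp add: s_def)
    ultimately show ?thesis by simp
  qed
  have "(\<lambda>m. (1 + (- (s * \<tau>)) / real m) ^ m) \<longlonglongrightarrow> exp (- (s * \<tau>))"
    by (rule tendsto_exp_limit_sequentially)
  then have "((\<lambda>m. (1 + (- (s * \<tau>)) / real m) ^ m) \<circ> (\<lambda>n. 2 * n)) \<longlonglongrightarrow> exp (- (s * \<tau>))"
    by (rule LIMSEQ_subseq_LIMSEQ) (simp add: strict_mono_def)
  then have "(\<lambda>n. prob A * (1 - s / real (2 * n) * \<tau>) ^ (2 * n)) \<longlonglongrightarrow> prob A * exp (- (s * \<tau>))"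
    by (intro tendsto_mult_left) (simp add: comp_def)
  moreover have "(\<lambda>n. real DIM('b) * (1 - c n * \<kappa>) ^ card I)
      \<longlonglongrightarrow> real DIM('b) * (1 - (1 - t) / R * \<kappa>) ^ card I"
    by (intro tendsto_intros c_lim)
  ultimately have "prob A * exp (- (s * \<tau>)) \<le> real DIM('b) * (1 - (1 - t) / R * \<kappa>) ^ card I"
    using bound by (intro tendsto_le[OF sequentially_bot])
  also have "\<dots> \<le> real DIM('b) * exp (- ((1 - t) / R * \<kappa>)) ^ card I"
  proof -
    have "(1 - t) / R * \<kappa> = (1 - t) * (\<kappa> / R)" by simp
    also have "\<dots> \<le> 1 * 1" using t \<kappa> R by (intro mult_mono) auto
    finally show ?thesis
      using exp_ge_add_one_self[of "- ((1 - t) / R * \<kappa>)"] by (intro mult_left_mono power_mono) auto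
  qed
  finally have "prob A * exp (- (s * \<tau>)) * exp (s * \<tau>)
      \<le> real DIM('b) * exp (- ((1 - t) / R * \<kappa>)) ^ card I * exp (s * \<tau>)"
    by (rule mult_right_mono) simp
  then have "prob A \<le> real DIM('b) * exp (s * \<tau> - N * ((1 - t) / R * \<kappa>))"
    by (simp add: exp_minus exp_diff exp_of_nat_mult[symmetric] N_def field_simps)
  also have "s * \<tau> - N * ((1 - t) / R * \<kappa>) = - (N * \<kappa> / R * (1 - t + t * ln t))"
    using R by (simp add: s_def \<tau>_def field_simps)
  also have "\<dots> \<le> - (N * \<kappa> / R * ((1 - t)\<^sup>2 / 2))"
    using half_square_le_entropy[OF t] \<kappa> R
    by (intro le_imp_neg_le mult_left_mono) (auto simp: N_def)
  finally show ?thesis by (simp add: N_def mult_ac)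
qed

section \<open>Leverage scores and the incoherence assumptions\<close>

lemma orth_proj_span_orthonormal:
  fixes u :: "nat \<Rightarrow> 'a::euclidean_space"
  assumes u: "orthonormal_family k u"
  shows "orth_proj (span (u ` {1..k})) x = (\<Sum>i=1..k. (u i \<bullet> x) *\<^sub>R u i)" (is "_ = ?y")
proof -
  have "orthogonal (x - ?y) w" if "w \<in> span (u ` {1..k})" for w
  proof (rule orthogonal_to_span[OF that])
    fix w assume "w \<in> u ` {1..k}"
    then obtain j where j: "j \<in> {1..k}" "w = u j" by blast
    have "?y \<bullet> u j = (\<Sum>i=1..k. if i = j then u j \<bullet> x else 0)"
      unfolding inner_sum_left using u j by (intro sum.cong) (auto simp: orthonormal_family_def)
    then show "orthogonal (x - ?y) w" using j by (simp add: orthogonal_def inner_diff_left inner_diff_right inner_commute[of _ "u j"])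
  qed
  moreover have "?y \<in> span (u ` {1..k})" by (intro span_sum span_scale span_base imageI)
  ultimately show ?thesis
    unfolding orth_proj_def by (intro the1_equality orth_proj_unique_existence) auto
qed

lemma inner_sum_orthonormal:
  fixes u :: "nat \<Rightarrow> 'a::real_inner"
  assumes u: "orthonormal_family k u"
  shows "(\<Sum>i=1..k. a i *\<^sub>R u i) \<bullet> (\<Sum>i=1..k. a i *\<^sub>R u i) = (\<Sum>i=1..k. (a i)\<^sup>2)"
proof -
  have "(\<Sum>i=1..k. a i *\<^sub>R u i) \<bullet> u j = a j" if j: "j \<in> {1..k}" for j
  proof -
    have "(\<Sum>i=1..k. a i *\<^sub>R u i) \<bullet> u j = (\<Sum>i=1..k. if i = j then a j else 0)"
      unfolding inner_sum_left using u j by (intro sum.cong) (auto simp: orthonormal_family_def)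
    then show ?thesis using j by simp
  qed
  then show ?thesis by (simp add: inner_sum_right[of _ "\<lambda>i. a i *\<^sub>R u i"] power2_eq_square)
qed

lemma coherence_orthonormal:
  fixes u :: "nat \<Rightarrow> real^'n"
  assumes u: "orthonormal_family k u"
  shows "coherence r (span (u ` {1..k})) =
    real CARD('n) / real r * Max (range (\<lambda>i::'n. \<Sum>j=1..k. (u j $ i)\<^sup>2))"
proof -
  have "(norm (orth_proj (span (u ` {1..k})) (axis i 1)))\<^sup>2 = (\<Sum>j=1..k. (u j $ i)\<^sup>2)" for i
    by (simp add: power2_norm_eq_inner orth_proj_span_orthonormal[OF u] inner_sum_orthonormal[OF u] inner_axis
        del: One_nat_def)
  then show ?thesis by (simp add: coherence_def)
qed

lemma coherence_orthonormal_le_iff: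
  fixes u :: "nat \<Rightarrow> real^'n"
  assumes u: "orthonormal_family k u"
  shows "coherence r (span (u ` {1..k})) \<le> \<mu> \<longleftrightarrow>
    (\<forall>i::'n. real CARD('n) / real r * (\<Sum>j=1..k. (u j $ i)\<^sup>2) \<le> \<mu>)"
proof -
  define f where "f = (\<lambda>i::'n. \<Sum>j=1..k. (u j $ i)\<^sup>2)"
  define c where "c = real CARD('n) / real r"
  have c: "0 \<le> c" by (simp add: c_def)
  have "Max (range f) \<in> range f" by (intro Max_in) auto
  moreover have "f i \<le> Max (range f)" for i by (intro Max_ge) auto
  then have "c * f i \<le> c * Max (range f)" for i using c by (intro mult_left_mono)
  ultimately have "c * Max (range f) \<le> \<mu> \<longleftrightarrow> (\<forall>i. c * f i \<le> \<mu>)"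
    by (smt (verit, best) imageE)
  then show ?thesis by (simp only: coherence_orthonormal[OF u] f_def c_def)
qed

lemma max_entry_le_iff: "max_entry W \<le> c \<longleftrightarrow> (\<forall>i j. \<bar>W $ i $ j\<bar> \<le> c)"
proof -
  have "{\<bar>W $ i $ j\<bar> | i j. True} = (\<lambda>(i, j). \<bar>W $ i $ j\<bar>) ` UNIV" by auto
  then show ?thesis by (simp add: max_entry_def)
qed

lemma sum_outer_nth: "(\<Sum>k\<in>K. outer (u k) (v k)) $ i $ j = (\<Sum>k\<in>K. u k $ i * v k $ j)"
  by (simp add: outer_def)

lemma A0_A1_iff:
  fixes M :: "real^'n^'m"
  shows "A0 r \<mu>\<^sub>0 M \<and> A1 r \<mu>\<^sub>1 M \<longleftrightarrow> (\<forall>\<sigma> u v. compact_svd M \<sigma> u v \<longrightarrow>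
    (\<forall>i. real CARD('m) / real r * (\<Sum>k=1..rank M. (u k $ i)\<^sup>2) \<le> \<mu>\<^sub>0) \<and>
    (\<forall>i. real CARD('n) / real r * (\<Sum>k=1..rank M. (v k $ i)\<^sup>2) \<le> \<mu>\<^sub>0) \<and>
    (\<forall>i j. \<bar>\<Sum>k=1..rank M. u k $ i * v k $ j\<bar> \<le> \<mu>\<^sub>1 * sqrt (real r / (real CARD('m) * real CARD('n)))))"
proof -
  have "max (coherence r (span (u ` {1..rank M}))) (coherence r (span (v ` {1..rank M}))) \<le> \<mu>\<^sub>0 \<longleftrightarrow>
     (\<forall>i. real CARD('m) / real r * (\<Sum>k=1..rank M. (u k $ i)\<^sup>2) \<le> \<mu>\<^sub>0) \<and>
     (\<forall>i. real CARD('n) / real r * (\<Sum>k=1..rank M. (v k $ i)\<^sup>2) \<le> \<mu>\<^sub>0)"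
    if "compact_svd M \<sigma> u v" for \<sigma> u v
    using that unfolding compact_svd_def by (simp only: max.bounded_iff coherence_orthonormal_le_iff)
  then show ?thesis
    unfolding A0_def A1_def max_entry_le_iff sum_outer_nth by blast
qed

text \<open>The leverage \<open>q\<close> is both the squared norm and the \<open>i\<close>-th entry
  of the projection of the \<open>i\<close>-th basis vector. Writing this projection as the image of
  some \<open>v\<close>, the first description gives \<open>v \<bullet> v \<le> q / \<beta>\<close>,
  and Cauchy-Schwarz in the second gives \<open>q^2 \<le> R q / \<beta>\<close>.\<close>

lemma leverage_score_le:
  fixes X :: "'n::finite \<Rightarrow> 'b::euclidean_space" and u :: "nat \<Rightarrow> real^'n"
  assumes u: "orthonormal_family k u"
    and sub: "span (u ` {1..k}) \<subseteq> range (\<lambda>v. \<chi> i. X i \<bullet> v)"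
    and \<beta>: "0 < \<beta>" "\<And>v. \<beta> * (v \<bullet> v) \<le> (\<Sum>i\<in>UNIV. (X i \<bullet> v)\<^sup>2)"
    and R: "X i \<bullet> X i \<le> R"
  shows "(\<Sum>j=1..k. (u j $ i)\<^sup>2) \<le> R / \<beta>"
proof -
  define q where "q = (\<Sum>j=1..k. (u j $ i)\<^sup>2)"
  define y where "y = (\<Sum>j=1..k. (u j $ i) *\<^sub>R u j)"
  have "y \<in> span (u ` {1..k})" unfolding y_def by (intro span_sum span_scale span_base imageI)
  then obtain v where v: "y = (\<chi> i. X i \<bullet> v)" using sub by blast
  have yy: "y \<bullet> y = q" unfolding y_def q_def by (rule inner_sum_orthonormal[OF u])
  have yi: "X i \<bullet> v = q" using arg_cong[OF v, of "\<lambda>y. y $ i"] by (simp add: y_def q_def power2_eq_square)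
  have "\<beta> * (v \<bullet> v) \<le> q" using \<beta>(2)[of v] yy by (simp add: v inner_vec_def power2_eq_square)
  then have vv: "v \<bullet> v \<le> q / \<beta>" using \<beta>(1) by (simp add: field_simps)
  have q: "0 \<le> q" by (simp add: q_def sum_nonneg)
  have R0: "0 \<le> R" using R inner_ge_zero[of "X i"] by linarith
  have "q\<^sup>2 \<le> (X i \<bullet> X i) * (v \<bullet> v)" using Cauchy_Schwarz_ineq[of "X i" v] yi by simp
  also have "\<dots> \<le> R * (q / \<beta>)" using R vv R0 by (intro mult_mono) auto
  finally have "q * q \<le> (R / \<beta>) * q" by (simp add: power2_eq_square)
  then have "q \<le> R / \<beta>" if "q \<noteq> 0" using q that mult_le_cancel_right_pos[of q q "R / \<beta>"] by linarith
  moreover have "0 \<le> R / \<beta>" using R0 \<beta>(1) by simp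
  ultimately show ?thesis unfolding q_def by fastforce
qed

lemma compact_svd_column_space:
  assumes "compact_svd M \<sigma> u v"
  shows "span (u ` {1..rank M}) = range ((*v) M)"
proof -
  have M: "M = (\<Sum>i=1..rank M. \<sigma> i *\<^sub>R outer (u i) (v i))" and v: "orthonormal_family (rank M) v"
    and pos: "\<forall>i\<in>{1..rank M}. 0 < \<sigma> i"
    using assms unfolding compact_svd_def by blast+
  show ?thesis by (rule orthonormal_expansion_range[OF M v pos, symmetric])
qed

lemma compact_svd_transpose:
  assumes "compact_svd M \<sigma> u v"
  shows "compact_svd (transpose M) \<sigma> v u"
proof -
  have "M = (\<Sum>i=1..rank M. \<sigma> i *\<^sub>R outer (u i) (v i))"
    using assms unfolding compact_svd_def by blast
  then have "transpose M = transpose (\<Sum>i=1..rank M. \<sigma> i *\<^sub>R outer (u i) (v i))"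
    by (rule arg_cong)
  also have "\<dots> = (\<Sum>i=1..rank M. \<sigma> i *\<^sub>R outer (v i) (u i))"
    by (simp add: transpose_def vec_eq_iff outer_def mult_ac)
  finally have "transpose M = (\<Sum>i=1..rank M. \<sigma> i *\<^sub>R outer (v i) (u i))" .
  then show ?thesis using assms unfolding compact_svd_def rank_transpose by blast
qed

section \<open>The deterministic criterion for distance matrices\<close>

text \<open>With \<open>X\<^sub>i = (1, p\<^sub>i, \<parallel>p\<^sub>i\<parallel>\<^sup>2)\<close>, the matrix entry is bilinear in \<open>X\<^sub>i\<close> and \<open>X\<^sub>j\<close>.\<close>

definition lift_point :: "real^'d \<Rightarrow> real \<times> (real^'d) \<times> real" where
  "lift_point p = (1, p, p \<bullet> p)"

lemma range_edm_subset: "range ((*v) (edm p)) \<subseteq> range (\<lambda>v. \<chi> i. lift_point (p i) \<bullet> v)"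
proof (rule image_subsetI)
  fix z
  \<comment> \<open>Expansion of \<open>|p_i|^2 - 2 p_i \<bullet> p_j + |p_j|^2\<close>: the
    components of the witness are the coefficients of 1, \<open>p_i\<close> and
    \<open>|p_i|^2\<close>.\<close>
  have "edm p *v z = (\<chi> i. lift_point (p i) \<bullet>
      ((\<Sum>j\<in>UNIV. z $ j * (p j \<bullet> p j)), - 2 *\<^sub>R (\<Sum>j\<in>UNIV. z $ j *\<^sub>R p j), (\<Sum>j\<in>UNIV. z $ j)))"
    by (simp add: vec_eq_iff edm_def matrix_vector_mult_def lift_point_def power2_norm_eq_inner
        inner_diff_left inner_diff_right inner_sum_right inner_commute algebra_simps sum.distrib
        sum_subtractf sum_distrib_left sum_distrib_right)
  then show "edm p *v z \<in> range (\<lambda>v. \<chi> i. lift_point (p i) \<bullet> v)" by blast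
qed

text \<open>The leverage bound uses only that the column space is contained in the image of the
  lift, so it is insensitive to the actual rank, and \<open>r\<close> acts purely as a
  normalization.\<close>

lemma edm_A0_A1:
  fixes p :: "'n::finite \<Rightarrow> real^'d"
  assumes \<beta>: "0 < \<beta>" "\<And>v. \<beta> * (v \<bullet> v) \<le> (\<Sum>i\<in>UNIV. (lift_point (p i) \<bullet> v)\<^sup>2)"
    and R: "\<And>i. lift_point (p i) \<bullet> lift_point (p i) \<le> R"
    and \<mu>\<^sub>0: "real CARD('n) / real r * (R / \<beta>) \<le> \<mu>\<^sub>0"
    and \<mu>\<^sub>1: "R / \<beta> \<le> \<mu>\<^sub>1 * sqrt (real r / (real CARD('n) * real CARD('n)))"
  shows "A0 r \<mu>\<^sub>0 (edm p) \<and> A1 r \<mu>\<^sub>1 (edm p)"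
  unfolding A0_A1_iff
proof (intro allI impI)
  fix \<sigma> u v assume svd: "compact_svd (edm p) \<sigma> u v"
  \<comment> \<open>By symmetry, swapping left and right singular vectors yields another
    decomposition of the same matrix, so one leverage bound serves both spaces.\<close>
  have "transpose (edm p) = edm p"
    by (simp add: transpose_def edm_def vec_eq_iff norm_minus_commute)
  then have svd': "compact_svd (edm p) \<sigma> v u" using compact_svd_transpose[OF svd] by simp
  have lev: "(\<Sum>k=1..rank (edm p). (w k $ i)\<^sup>2) \<le> R / \<beta>" if "compact_svd (edm p) \<sigma> w w'" for w w' i
    using that range_edm_subset[of p] compact_svd_column_space[OF that]
    by (intro leverage_score_le[where X = "\<lambda>i. lift_point (p i)"] \<beta> R) (auto simp: compact_svd_def)
  have coh: "real CARD('n) / real r * (\<Sum>k=1..rank (edm p). (w k $ i)\<^sup>2) \<le> \<mu>\<^sub>0"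
    if "compact_svd (edm p) \<sigma> w w'" for w w' i
    by (rule order_trans[OF mult_left_mono[OF lev[OF that]] \<mu>\<^sub>0]) simp
  have "\<bar>\<Sum>k=1..rank (edm p). u k $ i * v k $ j\<bar> \<le> R / \<beta>" for i j
  proof -
    have "0 \<le> R / \<beta>" using lev[OF svd, of i] by (meson order_trans sum_nonneg zero_le_power2)
    have "(\<Sum>k=1..rank (edm p). u k $ i * v k $ j)\<^sup>2
        \<le> (\<Sum>k=1..rank (edm p). (u k $ i)\<^sup>2) * (\<Sum>k=1..rank (edm p). (v k $ j)\<^sup>2)"
      by (rule Cauchy_Schwarz_ineq_sum)
    also have "\<dots> \<le> (R / \<beta>) * (R / \<beta>)"
      using \<open>0 \<le> R / \<beta>\<close> by (intro mult_mono lev[OF svd] lev[OF svd'] sum_nonneg) auto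
    finally have "\<bar>\<Sum>k=1..rank (edm p). u k $ i * v k $ j\<bar> \<le> \<bar>R / \<beta>\<bar>"
      unfolding abs_le_square_iff by (simp only: power2_eq_square)
    then show ?thesis using \<open>0 \<le> R / \<beta>\<close> by (simp only: abs_of_nonneg)
  qed
  then show "(\<forall>i. real CARD('n) / real r * (\<Sum>k=1..rank (edm p). (u k $ i)\<^sup>2) \<le> \<mu>\<^sub>0) \<and>
    (\<forall>i. real CARD('n) / real r * (\<Sum>k=1..rank (edm p). (v k $ i)\<^sup>2) \<le> \<mu>\<^sub>0) \<and>
    (\<forall>i j. \<bar>\<Sum>k=1..rank (edm p). u k $ i * v k $ j\<bar>
       \<le> \<mu>\<^sub>1 * sqrt (real r / (real CARD('n) * real CARD('n))))"
    using coh[OF svd] coh[OF svd'] \<mu>\<^sub>1 order_trans by blast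
qed

section \<open>Measurability of the incoherence event\<close>

text \<open>Tychonoff's theorem in the product topology on functions; it covers families of singular
  values and vectors given as total functions on \<open>nat\<close>.\<close>

lemma compact_Pi_UNIV:
  fixes S :: "'i \<Rightarrow> 'a::topological_space set"
  assumes "\<And>i. compact (S i)"
  shows "compact {f. \<forall>i. f i \<in> S i}"
proof -
  have "compactin (product_topology (\<lambda>i. euclidean) UNIV) (PiE UNIV S)"
    using assms by (simp add: compactin_PiE)
  moreover have "PiE UNIV S = {f. \<forall>i. f i \<in> S i}" by (auto simp: PiE_def Pi_def)
  ultimately show ?thesis by (simp add: euclidean_product_topology)
qed

lemma continuous_on_fst_app [continuous_intros]:
  "continuous_on S f \<Longrightarrow> continuous_on S (\<lambda>x. fst (f x) i)"
  by (rule continuous_on_product_then_coordinatewise) (rule continuous_on_fst)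

lemma continuous_on_snd_app [continuous_intros]:
  "continuous_on S f \<Longrightarrow> continuous_on S (\<lambda>x. snd (f x) i)"
  by (rule continuous_on_product_then_coordinatewise) (rule continuous_on_snd)

text \<open>
  The set is a countable union of continuous images of compact sets of triples
  \<open>(\<sigma>, u, v)\<close>, exhausting the open conditions \<open>\<sigma> i > 0\<close> and \<open>F k u v > c\<close> from inside.
\<close>

lemma borel_compact_svd_exists:
  fixes F :: "nat \<Rightarrow> (nat \<Rightarrow> real^'m) \<times> (nat \<Rightarrow> real^'n) \<Rightarrow> real"
  assumes cont: "\<And>k. continuous_on UNIV (F k)"
    and agree: "\<And>k u v u' v'. (\<And>i. i \<in> {1..k} \<Longrightarrow> u i = u' i \<and> v i = v' i) \<Longrightarrow> F k (u, v) = F k (u', v')"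
  shows "{M :: real^'n^'m. \<exists>\<sigma> u v. compact_svd M \<sigma> u v \<and> c < F (rank M) (u, v)} \<in> sets borel"
proof -
  \<comment> \<open>Components with index beyond \<open>k\<close> are bounded as well, since
    compactness concerns whole functions. The constraints relax as \<open>m\<close> grows, so every
    decomposition, suitably padded, is reached for some \<open>m\<close>.\<close>
  define D where "D = (\<lambda>k m. {w :: (nat \<Rightarrow> real) \<times> (nat \<Rightarrow> real^'m) \<times> (nat \<Rightarrow> real^'n).
      w \<in> {\<sigma>. \<forall>i. \<sigma> i \<in> {inverse (real (Suc m))..real (Suc m)}} \<times> {u. \<forall>i. u i \<in> cball 0 1} \<times> {v. \<forall>i. v i \<in> cball 0 1}} \<inter>
      ((\<Inter>i\<in>{1..k}. \<Inter>j\<in>{1..k}. {w. fst (snd w) i \<bullet> fst (snd w) j = (if i = j then 1 else 0)}) \<inter>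
       (\<Inter>i\<in>{1..k}. \<Inter>j\<in>{1..k}. {w. snd (snd w) i \<bullet> snd (snd w) j = (if i = j then 1 else 0)}) \<inter>
       {w. c + inverse (real (Suc m)) \<le> F k (snd w)}))"
  define \<Phi> where "\<Phi> = (\<lambda>k (w :: (nat \<Rightarrow> real) \<times> (nat \<Rightarrow> real^'m) \<times> (nat \<Rightarrow> real^'n)).
      \<Sum>i=1..k. fst w i *\<^sub>R outer (fst (snd w) i) (snd (snd w) i))"
  have comp: "compact (D k m)" for k m
  proof -
    have "compact ({\<sigma> :: nat \<Rightarrow> real. \<forall>i. \<sigma> i \<in> {inverse (real (Suc m))..real (Suc m)}} \<times>
        {u :: nat \<Rightarrow> real^'m. \<forall>i. u i \<in> cball 0 1} \<times> {v :: nat \<Rightarrow> real^'n. \<forall>i. v i \<in> cball 0 1})"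
      by (intro compact_Times compact_Pi_UNIV compact_Icc compact_cball)
    moreover have "closed {w :: (nat \<Rightarrow> real) \<times> (nat \<Rightarrow> real^'m) \<times> (nat \<Rightarrow> real^'n).
        fst (snd w) i \<bullet> fst (snd w) j = (if i = j then 1 else 0)}" for i j
      by (intro closed_Collect_eq continuous_intros)
    moreover have "closed {w :: (nat \<Rightarrow> real) \<times> (nat \<Rightarrow> real^'m) \<times> (nat \<Rightarrow> real^'n).
        snd (snd w) i \<bullet> snd (snd w) j = (if i = j then 1 else 0)}" for i j
      by (intro closed_Collect_eq continuous_intros)
    moreover have "closed {w :: (nat \<Rightarrow> real) \<times> (nat \<Rightarrow> real^'m) \<times> (nat \<Rightarrow> real^'n).
        c + inverse (real (Suc m)) \<le> F k (snd w)}"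
      by (intro closed_Collect_le continuous_on_const continuous_on_compose2[OF cont])
        (auto intro!: continuous_on_snd continuous_on_id)
    ultimately show ?thesis
      unfolding D_def Collect_mem_eq by (intro compact_Int_closed closed_Int closed_INT ballI)
  qed
  have "continuous_on UNIV (\<Phi> k)" for k
    unfolding \<Phi>_def outer_def by (intro continuous_intros)
  then have "compact (\<Phi> k ` D k m)" for k m
    using comp by (intro compact_continuous_image) (auto intro: continuous_on_subset)
  then have "(\<Union>k. \<Union>m. \<Phi> k ` D k m) \<in> sets borel"
    by (intro sets.countable_UN'' countableI_type borel_compact)
  also have "(\<Union>k. \<Union>m. \<Phi> k ` D k m) = {M. \<exists>\<sigma> u v. compact_svd M \<sigma> u v \<and> c < F (rank M) (u, v)}"
  proof (intro equalityI subsetI)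
    fix M assume "M \<in> (\<Union>k. \<Union>m. \<Phi> k ` D k m)"
    then obtain k m w where "w \<in> D k m" "M = \<Phi> k w" by blast
    then obtain \<sigma> u v where w: "(\<sigma>, u, v) \<in> D k m" and M: "M = \<Phi> k (\<sigma>, u, v)"
      using prod_cases3 by metis
    have ge: "inverse (real (Suc m)) \<le> \<sigma> i" for i using w by (auto simp: D_def)
    have pos: "\<forall>i\<in>{1..k}. 0 < \<sigma> i"
      using less_le_trans[OF _ ge] by simp
    have u: "orthonormal_family k u" and v: "orthonormal_family k v"
      and F: "c + inverse (real (Suc m)) \<le> F k (u, v)"
      using w by (auto simp: D_def orthonormal_family_def)
    have M': "M = (\<Sum>i=1..k. \<sigma> i *\<^sub>R outer (u i) (v i))" by (simp add: M \<Phi>_def)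
    \<comment> \<open>Positivity and orthonormality determine the rank, which ties \<open>k\<close>
      to the matrix.\<close>
    have rank: "rank M = k" by (rule orthonormal_expansion_rank[OF M' u v pos])
    have "0 < inverse (real (Suc m))" by simp
    then have "c < F k (u, v)" using F by linarith
    then show "M \<in> {M. \<exists>\<sigma> u v. compact_svd M \<sigma> u v \<and> c < F (rank M) (u, v)}"
      unfolding mem_Collect_eq compact_svd_def rank using M' u v pos by blast
  next
    fix M assume "M \<in> {M. \<exists>\<sigma> u v. compact_svd M \<sigma> u v \<and> c < F (rank M) (u, v)}"
    then obtain \<sigma> u v where svd: "compact_svd M \<sigma> u v" and F: "c < F (rank M) (u, v)" by blast
    define k where "k = rank M"
    \<comment> \<open>The padding values lie in the boxes for every \<open>m\<close>; by
      \<open>agree\<close>, \<open>F k\<close> reads only the components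
      \<open>1..k\<close>.\<close>
    define \<sigma>' u' v' where "\<sigma>' = (\<lambda>i. if i \<in> {1..k} then \<sigma> i else 1)"
      and "u' = (\<lambda>i. if i \<in> {1..k} then u i else 0)" and "v' = (\<lambda>i. if i \<in> {1..k} then v i else 0)"
    have F': "F k (u', v') = F k (u, v)" by (rule agree) (auto simp: u'_def v'_def)
    have pos: "\<forall>i\<in>{1..k}. 0 < \<sigma> i" and u: "orthonormal_family k u" and v: "orthonormal_family k v"
      and M: "M = (\<Sum>i=1..k. \<sigma> i *\<^sub>R outer (u i) (v i))"
      using svd by (simp_all add: compact_svd_def k_def)
    have M': "M = \<Phi> k (\<sigma>', u', v')"
      unfolding \<Phi>_def by (subst M) (auto intro!: sum.cong simp: \<sigma>'_def u'_def v'_def)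
    have ball: "u' i \<in> cball 0 1" "v' i \<in> cball 0 1" for i
      using u v by (auto simp: u'_def v'_def orthonormal_family_def norm_eq_sqrt_inner)
    \<comment> \<open>Dominates every singular value, every reciprocal of one, and the reciprocal of
      the gap \<open>F k (u, v) - c\<close>, so that a single \<open>m\<close> meets all
      constraints.\<close>
    define B where "B = 1 + (\<Sum>i=1..k. \<sigma> i + inverse (\<sigma> i)) + inverse (F k (u, v) - c)"
    obtain m where "B \<le> real m" using real_arch_simple by blast
    then have m: "B \<le> real (Suc m)" by simp
    have Fpos: "0 < inverse (F k (u, v) - c)" using F by (simp add: k_def)
    have nonneg: "0 \<le> \<sigma> i + inverse (\<sigma> i)" if "i \<in> {1..k}" for i
      using bspec[OF pos that] by simp
    have summand: "\<sigma> i + inverse (\<sigma> i) \<le> (\<Sum>i=1..k. \<sigma> i + inverse (\<sigma> i))" if "i \<in> {1..k}" for i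
      by (rule member_le_sum[OF that]) (use nonneg in auto)
    have sum_nonneg: "0 \<le> (\<Sum>i=1..k. \<sigma> i + inverse (\<sigma> i))"
      by (rule sum_nonneg) (rule nonneg)
    have \<sigma>': "\<sigma>' i \<in> {inverse (real (Suc m))..real (Suc m)}" for i
    proof (cases "i \<in> {1..k}")
      case True
      have \<sigma>i: "0 < \<sigma> i" "0 < inverse (\<sigma> i)" using bspec[OF pos True] by simp_all
      have "\<sigma> i \<le> real (Suc m)" "inverse (\<sigma> i) \<le> real (Suc m)"
        using summand[OF True] m Fpos \<sigma>i unfolding B_def by linarith+
      then show ?thesis using \<sigma>i True le_imp_inverse_le[of "inverse (\<sigma> i)" "real (Suc m)"]
        by (simp add: \<sigma>'_def)
    next
      case False
      then show ?thesis by (auto simp: \<sigma>'_def intro: inverse_le_1_iff[THEN iffD2])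
    qed
    have "inverse (F k (u, v) - c) \<le> real (Suc m)" using m sum_nonneg unfolding B_def by linarith
    from le_imp_inverse_le[OF this Fpos] have "c + inverse (real (Suc m)) \<le> F k (u', v')"
      by (simp add: F')
    then have "(\<sigma>', u', v') \<in> D k m"
      using \<sigma>' ball u v unfolding D_def by (simp add: orthonormal_family_def u'_def v'_def del: of_nat_Suc)
    then show "M \<in> (\<Union>k. \<Union>m. \<Phi> k ` D k m)" using M' by blast
  qed
  finally show ?thesis .
qed

text \<open>The complement is a finite union, over entries, of sets covered by
  \<open>borel_compact_svd_exists\<close>: negation turns the universal quantifier over
  decompositions into the existential one there.\<close>

lemma borel_A0_A1: "{M :: real^'n^'m. A0 r \<mu>\<^sub>0 M \<and> A1 r \<mu>\<^sub>1 M} \<in> sets borel"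
proof -
  define c where "c = \<mu>\<^sub>1 * sqrt (real r / (real CARD('m) * real CARD('n)))"
  define bad where "bad = (\<lambda>(F :: nat \<Rightarrow> (nat \<Rightarrow> real^'m) \<times> (nat \<Rightarrow> real^'n) \<Rightarrow> real) c.
    {M :: real^'n^'m. \<exists>\<sigma> u v. compact_svd M \<sigma> u v \<and> c < F (rank M) (u, v)})"
  define F1 :: "'m \<Rightarrow> nat \<Rightarrow> (nat \<Rightarrow> real^'m) \<times> (nat \<Rightarrow> real^'n) \<Rightarrow> real"
    where "F1 = (\<lambda>i k w. real CARD('m) / real r * (\<Sum>j=1..k. (fst w j $ i)\<^sup>2))"
  define F2 :: "'n \<Rightarrow> nat \<Rightarrow> (nat \<Rightarrow> real^'m) \<times> (nat \<Rightarrow> real^'n) \<Rightarrow> real"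
    where "F2 = (\<lambda>i k w. real CARD('n) / real r * (\<Sum>j=1..k. (snd w j $ i)\<^sup>2))"
  define F3 :: "'m \<Rightarrow> 'n \<Rightarrow> nat \<Rightarrow> (nat \<Rightarrow> real^'m) \<times> (nat \<Rightarrow> real^'n) \<Rightarrow> real"
    where "F3 = (\<lambda>i j k w. \<bar>\<Sum>l=1..k. fst w l $ i * snd w l $ j\<bar>)"
  have F1: "bad (F1 i) \<mu>\<^sub>0 \<in> sets borel" for i
    unfolding bad_def
  proof (rule borel_compact_svd_exists)
    show "continuous_on UNIV (F1 i k)" for k unfolding F1_def by (intro continuous_intros)
  qed (auto simp: F1_def intro!: sum.cong)
  have F2: "bad (F2 i) \<mu>\<^sub>0 \<in> sets borel" for i
    unfolding bad_def
  proof (rule borel_compact_svd_exists)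
    show "continuous_on UNIV (F2 i k)" for k unfolding F2_def by (intro continuous_intros)
  qed (auto simp: F2_def intro!: sum.cong)
  have F3: "bad (F3 i j) c \<in> sets borel" for i j
    unfolding bad_def
  proof (rule borel_compact_svd_exists)
    show "continuous_on UNIV (F3 i j k)" for k unfolding F3_def by (intro continuous_intros)
  qed (auto simp: F3_def intro!: arg_cong[where f = abs] sum.cong)
  define B where "B = (\<Union>i. bad (F1 i) \<mu>\<^sub>0) \<union> (\<Union>i. bad (F2 i) \<mu>\<^sub>0) \<union> (\<Union>i. \<Union>j. bad (F3 i j) c)"
  have "B \<in> sets borel" unfolding B_def using F1 F2 F3 by (intro sets.Un sets.finite_UN) auto
  then have "UNIV - B \<in> sets borel" by (intro borel_comp[unfolded Compl_eq_Diff_UNIV])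
  also have "UNIV - B = {M. A0 r \<mu>\<^sub>0 M \<and> A1 r \<mu>\<^sub>1 M}"
  proof (rule set_eqI)
    fix M
    have "M \<in> B \<longleftrightarrow> \<not> (A0 r \<mu>\<^sub>0 M \<and> A1 r \<mu>\<^sub>1 M)"
      unfolding A0_A1_iff B_def bad_def F1_def F2_def F3_def c_def[symmetric] fst_conv snd_conv
        Un_iff UN_iff mem_Collect_eq not_less[symmetric] by blast
    then show "M \<in> UNIV - B \<longleftrightarrow> M \<in> {M. A0 r \<mu>\<^sub>0 M \<and> A1 r \<mu>\<^sub>1 M}" by blast
  qed
  finally show ?thesis .
qed

lemma borel_measurable_vec:
  fixes f :: "'a \<Rightarrow> 'b::euclidean_space^'n"
  assumes "\<And>i. (\<lambda>x. f x $ i) \<in> borel_measurable M"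
  shows "f \<in> borel_measurable M"
  unfolding borel_measurable_euclidean_space[of f] Basis_vec_def
  using assms by (auto simp: inner_axis)

section \<open>Second moments of the lifted uniform points\<close>

lemma integral_uniform_symmetric_power:
  "(\<integral>x. x ^ k \<partial>uniform_measure lborel {-1..1::real}) = (1 - (-1) ^ Suc k) / (2 * real (Suc k))"
proof -
  have "uniform_measure lborel {-1..1::real} = density lborel (\<lambda>x. ennreal (indicator {-1..1} x / 2))"
    unfolding uniform_measure_def
    by (intro density_cong) (auto simp: indicator_def divide_ennreal[of 1 2, simplified, symmetric])
  then have "(\<integral>x. x ^ k \<partial>uniform_measure lborel {-1..1::real})
      = (\<integral>x. (indicator {-1..1} x / 2) *\<^sub>R x ^ k \<partial>lborel)"
    by (simp add: integral_density)
  also have "\<dots> = (\<integral>x. (x ^ k * indicator {-1..1} x) / 2 \<partial>lborel)"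
    by (intro Bochner_Integration.integral_cong) auto
  also have "\<dots> = (\<integral>x. x ^ k * indicator {-1..1} x \<partial>lborel) / 2"
    by (rule integral_divide_zero)
  also have "\<dots> = (1 - (-1) ^ Suc k) / (2 * real (Suc k))"
    by (subst integral_power) auto
  finally show ?thesis .
qed

lemma AE_uniform_abs_le_1:
  fixes X :: "'a \<Rightarrow> real"
  assumes [measurable]: "X \<in> borel_measurable M"
    and unif: "distr M borel X = uniform_measure lborel {-1..1}"
  shows "AE \<omega> in M. \<bar>X \<omega>\<bar> \<le> 1"
proof -
  have "AE z in distr M borel X. \<bar>z\<bar> \<le> 1"
    unfolding unif by (rule AE_uniform_measureI) auto
  then show ?thesis by (subst (asm) AE_distr_iff) auto
qed

text \<open>Squared mean plus variance, with integrability supplied by boundedness. It serves for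
  linear forms of a lifted point, to which the coordinates contribute independent summands.\<close>

lemma (in prob_space) second_moment_sum_indep:
  fixes h :: "'i \<Rightarrow> 'a \<Rightarrow> real"
  assumes I: "finite I" and indep: "indep_vars (\<lambda>_. borel) h I"
    and bounded: "\<And>j. j \<in> I \<Longrightarrow> AE \<omega> in M. \<bar>h j \<omega>\<bar> \<le> C"
  shows "expectation (\<lambda>\<omega>. (a + (\<Sum>j\<in>I. h j \<omega>))\<^sup>2)
    = (a + (\<Sum>j\<in>I. expectation (h j)))\<^sup>2 + (\<Sum>j\<in>I. expectation (\<lambda>\<omega>. (h j \<omega>)\<^sup>2) - (expectation (h j))\<^sup>2)"
proof -
  have rv: "h j \<in> borel_measurable M" if "j \<in> I" for j
    using indep that by (simp add: indep_vars_def)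
  have int: "integrable M (h j)" if "j \<in> I" for j
    using bounded[OF that] rv[OF that] by (intro integrable_const_bound[where B = C]) auto
  have int2: "integrable M (\<lambda>\<omega>. h i \<omega> * h j \<omega>)" if "i \<in> I" "j \<in> I" for i j
  proof (rule integrable_const_bound)
    show "AE \<omega> in M. norm (h i \<omega> * h j \<omega>) \<le> C * C"
      using bounded[OF that(1)] bounded[OF that(2)]
    proof eventually_elim
      case (elim \<omega>)
      have "0 \<le> C" using elim(1) by linarith
      then show ?case using elim by (auto simp: abs_mult intro!: mult_mono)
    qed
  qed (use rv that in auto)
  define V where "V = (\<lambda>j. expectation (\<lambda>\<omega>. (h j \<omega>)\<^sup>2) - (expectation (h j))\<^sup>2)"
  have prod: "expectation (\<lambda>\<omega>. h i \<omega> * h j \<omega>)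
      = expectation (h i) * expectation (h j) + (if j = i then V i else 0)" if ij: "i \<in> I" "j \<in> I" for i j
  proof (cases "i = j")
    case True
    then show ?thesis by (simp add: V_def power2_eq_square)
  next
    case False
    have "indep_vars (\<lambda>_. borel) h {i, j}" using indep_vars_subset[OF indep] ij by simp
    then have "expectation (\<lambda>\<omega>. \<Prod>l\<in>{i, j}. h l \<omega>) = (\<Prod>l\<in>{i, j}. expectation (h l))"
      using ij int by (intro indep_vars_lebesgue_integral) auto
    then show ?thesis using False by simp
  qed
  have "expectation (\<lambda>\<omega>. (a + (\<Sum>j\<in>I. h j \<omega>))\<^sup>2)
      = expectation (\<lambda>\<omega>. a\<^sup>2 + 2 * a * (\<Sum>j\<in>I. h j \<omega>) + (\<Sum>i\<in>I. \<Sum>j\<in>I. h i \<omega> * h j \<omega>))"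
    by (intro Bochner_Integration.integral_cong refl) (simp add: power2_eq_square sum_product[symmetric] algebra_simps)
  also have "\<dots> = a\<^sup>2 + 2 * a * (\<Sum>j\<in>I. expectation (h j)) + (\<Sum>i\<in>I. \<Sum>j\<in>I. expectation (\<lambda>\<omega>. h i \<omega> * h j \<omega>))"
    using int int2 by (simp add: prob_space)
  also have "(\<Sum>i\<in>I. \<Sum>j\<in>I. expectation (\<lambda>\<omega>. h i \<omega> * h j \<omega>))
      = (\<Sum>i\<in>I. \<Sum>j\<in>I. expectation (h i) * expectation (h j) + (if j = i then V i else 0))"
    by (intro sum.cong refl prod)
  also have "\<dots> = (\<Sum>j\<in>I. expectation (h j))\<^sup>2 + (\<Sum>j\<in>I. V j)"
    using I by (simp add: sum.distrib sum_product[symmetric] power2_eq_square)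
  finally show ?thesis by (simp add: V_def power2_eq_square algebra_simps)
qed

text \<open>The least eigenvalue of the second moment matrix of a lifted uniform point.\<close>

definition kappa :: "nat \<Rightarrow> real" where
  "kappa d = (zeta d - sqrt ((zeta d)\<^sup>2 - 720 * real d)) / 90"

text \<open>This is the discriminant \<open>(a - c)^2 + 4 b^2\<close> of the characteristic
  polynomial of the symmetric 2 by 2 matrix with diagonal \<open>45\<close>,
  \<open>5 d^2 + 4 d\<close> and off-diagonal entry \<open>15 d\<close>.\<close>

lemma zeta_discriminant_nonneg: "0 \<le> (zeta d)\<^sup>2 - 720 * real d"
proof -
  have "(zeta d)\<^sup>2 - 720 * real d = (5 * (real d)\<^sup>2 + 4 * real d - 45)\<^sup>2 + 900 * (real d)\<^sup>2"
    by (simp add: zeta_def power2_eq_square algebra_simps)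
  then show ?thesis by simp
qed

text \<open>Characteristic equation, times 45, of the block
  \<open>[[1, d/3], [d/3, d^2/9 + 4 d/45]]\<close> of second moments of 1 and \<open>|p|^2\<close>:
  its trace is \<open>zeta d / 45\<close> and its determinant \<open>4 d / 45\<close>.\<close>

lemma kappa_root: "45 * (kappa d)\<^sup>2 - zeta d * kappa d + 4 * real d = 0"
proof -
  define s where "s = sqrt ((zeta d)\<^sup>2 - 720 * real d)"
  have "s * s = (zeta d)\<^sup>2 - 720 * real d"
    using zeta_discriminant_nonneg[of d] by (simp add: s_def)
  moreover have "s = zeta d - 90 * kappa d" unfolding kappa_def s_def by (simp add: field_simps)
  ultimately have "(zeta d - 90 * kappa d) * (zeta d - 90 * kappa d) = (zeta d)\<^sup>2 - 720 * real d" by simp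
  then show ?thesis by (simp add: power2_eq_square algebra_simps)
qed

lemma kappa_pos: "0 < d \<Longrightarrow> 0 < kappa d"
proof -
  assume d: "0 < d"
  have z: "0 \<le> zeta d" by (simp add: zeta_def)
  have "sqrt ((zeta d)\<^sup>2 - 720 * real d) < sqrt ((zeta d)\<^sup>2)" using d by (intro real_sqrt_less_mono) simp
  then show ?thesis using z by (simp add: kappa_def)
qed

text \<open>The other block of the second moment matrix is one third of the identity, so the least
  eigenvalue sits in the 2 by 2 block.\<close>

lemma kappa_le: "kappa d \<le> 1 / 3"
proof -
  have "(zeta d - 30)\<^sup>2 \<le> (zeta d)\<^sup>2 - 720 * real d"
  proof -
    have "0 \<le> 5 * (real d - 4/5)\<^sup>2 + 134/5" by simp
    then have "15 + 12 * real d \<le> zeta d" by (simp add: zeta_def power2_eq_square algebra_simps)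
    then show ?thesis by (simp add: power2_eq_square algebra_simps)
  qed
  then have "zeta d - 30 \<le> sqrt ((zeta d)\<^sup>2 - 720 * real d)" by (rule real_le_rsqrt)
  then show ?thesis by (simp add: kappa_def)
qed

lemma theta_eq: "theta d = (1 + real d + (real d)\<^sup>2) / kappa d"
  by (simp add: theta_def kappa_def)

text \<open>The 2 by 2 block minus \<open>kappa d\<close> is singular. Multiplying its form by the
  positive corner entry \<open>1 - kappa d\<close> and completing the square leaves a perfect
  square, since the remaining coefficient of \<open>b^2\<close> is the characteristic polynomial at
  its root.\<close>

lemma kappa_form_le:
  assumes "0 \<le> w"
  shows "kappa d * (a\<^sup>2 + w + b\<^sup>2) \<le> (a + b * real d / 3)\<^sup>2 + (w / 3 + 4 * real d * b\<^sup>2 / 45)"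
proof -
  define k where "k = kappa d"
  define D where "D = real d"
  have k: "k \<le> 1 / 3" using kappa_le by (simp add: k_def)
  have root: "45 * k\<^sup>2 - (5 * D\<^sup>2 + 4 * D + 45) * k + 4 * D = 0"
    using kappa_root[of d] by (simp add: k_def D_def zeta_def)
  define Q where "Q = (a + b * D / 3)\<^sup>2 + 4 * D * b\<^sup>2 / 45 - k * (a\<^sup>2 + b\<^sup>2)"
  have "(1 - k) * Q = ((1 - k) * a + b * D / 3)\<^sup>2 + b\<^sup>2 * (45 * k\<^sup>2 - (5 * D\<^sup>2 + 4 * D + 45) * k + 4 * D) / 45"
    by (simp add: Q_def power2_eq_square field_simps)
  also have "\<dots> \<ge> 0" by (simp add: root)
  finally have "0 \<le> Q" using k by (simp add: zero_le_mult_iff)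
  moreover have "k * w \<le> w / 3" using mult_right_mono[OF k assms] by simp
  ultimately show ?thesis unfolding Q_def k_def[symmetric] D_def[symmetric] by (simp add: algebra_simps)
qed

lemma lift_point_inner: "lift_point p \<bullet> (a, w, b) = a + (\<Sum>j\<in>UNIV. w $ j * p $ j + b * (p $ j)\<^sup>2)"
  by (simp add: lift_point_def inner_vec_def sum.distrib sum_distrib_left power2_eq_square mult_ac)

lemma lift_point_norm_le:
  fixes p :: "real^'d"
  assumes "\<And>j. \<bar>p $ j\<bar> \<le> 1"
  shows "lift_point p \<bullet> lift_point p \<le> 1 + real CARD('d) + (real CARD('d))\<^sup>2"
proof -
  have "p \<bullet> p \<le> (\<Sum>j\<in>(UNIV :: 'd set). 1)"
    unfolding inner_vec_def using assms by (intro sum_mono) (simp add: abs_square_le_1 flip: power2_eq_square)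
  then have pp: "p \<bullet> p \<le> real CARD('d)" by simp
  then have "(p \<bullet> p) * (p \<bullet> p) \<le> real CARD('d) * real CARD('d)" by (intro mult_mono) auto
  with pp show ?thesis by (simp add: lift_point_def power2_eq_square)
qed

section \<open>Independent rows and the second moments of a lifted point\<close>

lemma (in prob_space) indep_vars_rows:
  assumes indep: "indep_vars (\<lambda>_. borel) (\<lambda>(i, j). x i j) (UNIV :: ('n \<times> 'd) set)"
    and g: "\<And>i. g i \<in> measurable (PiM ({i} \<times> UNIV) (\<lambda>_. borel)) N"
  shows "indep_vars (\<lambda>_. N) (\<lambda>i \<omega>. g i (\<lambda>(k, j) \<in> {i} \<times> UNIV. x k j \<omega>)) (UNIV :: 'n set)"
proof -
  have "indep_vars (\<lambda>i. PiM ({i} \<times> UNIV) (\<lambda>_. borel))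
      (\<lambda>i \<omega>. restrict (\<lambda>p. (case p of (i, j) \<Rightarrow> x i j) \<omega>) ({i} \<times> UNIV)) (UNIV :: 'n set)"
    by (rule indep_vars_restrict[OF indep]) (auto simp: disjoint_family_on_def)
  from indep_vars_compose2[OF this g] show ?thesis
    by (simp add: case_prod_beta' cong: restrict_cong)
qed

lemma (in prob_space) indep_vars_fixed_row:
  assumes indep: "indep_vars (\<lambda>_. borel) (\<lambda>(i, j). x i j) (UNIV :: ('n \<times> 'd) set)"
  shows "indep_vars (\<lambda>_. borel) (x i) UNIV"
proof -
  have "indep_vars (\<lambda>j. PiM {(i, j)} (\<lambda>_. borel))
      (\<lambda>j \<omega>. restrict (\<lambda>p. (case p of (i, j) \<Rightarrow> x i j) \<omega>) {(i, j)}) (UNIV :: 'd set)"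
    by (rule indep_vars_restrict[OF indep]) (auto simp: disjoint_family_on_def)
  from indep_vars_compose2[OF this, of "\<lambda>j f. f (i, j)" "\<lambda>_. borel"] show ?thesis by simp
qed

lemma (in prob_space) lift_point_second_moment:
  fixes q :: "'d::finite \<Rightarrow> 'a \<Rightarrow> real"
  assumes indep: "indep_vars (\<lambda>_. borel) q UNIV"
    and unif: "\<And>j. distr M borel (q j) = uniform_measure lborel {-1..1}"
  shows "kappa CARD('d) * (y \<bullet> y) \<le> expectation (\<lambda>\<omega>. (lift_point (\<chi> j. q j \<omega>) \<bullet> y)\<^sup>2)"
proof -
  obtain a w b where y: "y = (a, w, b)" by (metis prod_cases3)
  have rv[measurable]: "q j \<in> borel_measurable M" for j using indep by (simp add: indep_vars_def)
  have AE1: "AE \<omega> in M. \<bar>q j \<omega>\<bar> \<le> 1" for j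
    by (rule AE_uniform_abs_le_1[OF rv unif])
  have mom: "expectation (\<lambda>\<omega>. q j \<omega> ^ k) = (1 - (-1) ^ Suc k) / (2 * real (Suc k))" for j k
  proof -
    have "expectation (\<lambda>\<omega>. q j \<omega> ^ k) = (\<integral>z. z ^ k \<partial>distr M borel (q j))"
      by (subst integral_distr) auto
    then show ?thesis by (simp add: unif integral_uniform_symmetric_power)
  qed
  have int: "integrable M (\<lambda>\<omega>. q j \<omega> ^ k)" for j k
  proof (rule integrable_const_bound)
    show "AE \<omega> in M. norm (q j \<omega> ^ k) \<le> 1"
      using AE1[of j] by eventually_elim (simp add: power_abs power_le_one)
  qed simp
  \<comment> \<open>Pairing the lifted point with \<open>(a, w, b)\<close> gives \<open>a\<close>
    plus one such term per coordinate. Each term has mean \<open>b / 3\<close>, and the variance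
    coefficient \<open>1/5 - 1/9 = 4/45\<close> is the source of the 45 in
    \<open>zeta\<close>.\<close>
  define h where "h = (\<lambda>j \<omega>. w $ j * q j \<omega> + b * (q j \<omega>)\<^sup>2)"
  have indep_h: "indep_vars (\<lambda>_. borel) h UNIV"
    unfolding h_def by (rule indep_vars_compose2[OF indep, of "\<lambda>j z. w $ j * z + b * z\<^sup>2"]) simp
  have bounded: "AE \<omega> in M. \<bar>h j \<omega>\<bar> \<le> norm w + \<bar>b\<bar>" for j
    using AE1[of j]
  proof eventually_elim
    case (elim \<omega>)
    have "\<bar>w $ j * q j \<omega>\<bar> \<le> norm w * 1"
      unfolding abs_mult using elim component_le_norm_cart[of w j] by (intro mult_mono) auto
    moreover have "\<bar>b * (q j \<omega>)\<^sup>2\<bar> \<le> \<bar>b\<bar> * 1"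
      unfolding abs_mult using elim by (intro mult_left_mono) (auto simp: abs_square_le_1)
    ultimately show ?case unfolding h_def by linarith
  qed
  have Eh: "expectation (h j) = b / 3" for j
    using int[of j 1] int[of j 2] mom[of j 1] mom[of j 2] by (simp add: h_def)
  have Eh2: "expectation (\<lambda>\<omega>. (h j \<omega>)\<^sup>2) = (w $ j)\<^sup>2 / 3 + b\<^sup>2 / 5" for j
  proof -
    have "expectation (\<lambda>\<omega>. (h j \<omega>)\<^sup>2)
        = expectation (\<lambda>\<omega>. (w $ j)\<^sup>2 * q j \<omega> ^ 2 + 2 * (w $ j) * b * q j \<omega> ^ 3 + b\<^sup>2 * q j \<omega> ^ 4)"
      unfolding h_def
      by (intro Bochner_Integration.integral_cong refl) (simp add: power2_eq_square power3_eq_cube power4_eq_xxxx algebra_simps)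
    also have "\<dots> = (w $ j)\<^sup>2 * (1 / 3) + 2 * (w $ j) * b * 0 + b\<^sup>2 * (1 / 5)"
    proof -
      have m: "expectation (\<lambda>\<omega>. q j \<omega> ^ 2) = 1 / 3" "expectation (\<lambda>\<omega>. q j \<omega> ^ 3) = 0"
        "expectation (\<lambda>\<omega>. q j \<omega> ^ 4) = 1 / 5"
        unfolding mom by simp_all
      show ?thesis by (simp add: int m)
    qed
    finally show ?thesis by simp
  qed
  have "expectation (\<lambda>\<omega>. (lift_point (\<chi> j. q j \<omega>) \<bullet> y)\<^sup>2) = expectation (\<lambda>\<omega>. (a + (\<Sum>j\<in>UNIV. h j \<omega>))\<^sup>2)"
    by (simp add: y lift_point_inner h_def)
  also have "\<dots> = (a + (\<Sum>j\<in>(UNIV :: 'd set). b / 3))\<^sup>2 + (\<Sum>j\<in>UNIV. (w $ j)\<^sup>2 / 3 + b\<^sup>2 / 5 - (b / 3)\<^sup>2)"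
    by (subst second_moment_sum_indep[OF finite indep_h bounded]) (simp only: Eh Eh2)
  also have "\<dots> = (a + b * real CARD('d) / 3)\<^sup>2 + ((w \<bullet> w) / 3 + 4 * real CARD('d) * b\<^sup>2 / 45)"
  proof -
    have "(\<Sum>j\<in>UNIV. (w $ j)\<^sup>2 / 3 + b\<^sup>2 / 5 - (b / 3)\<^sup>2)
        = (\<Sum>j\<in>UNIV. (1 / 3) * (w $ j * w $ j) + 4 * b\<^sup>2 / 45)"
      by (intro sum.cong) (auto simp: power2_eq_square)
    also have "\<dots> = (w \<bullet> w) / 3 + 4 * real CARD('d) * b\<^sup>2 / 45"
      unfolding sum.distrib sum_distrib_left[symmetric] by (simp add: inner_vec_def)
    finally show ?thesis by (simp add: mult.commute)
  qed
  also have "\<dots> \<ge> kappa CARD('d) * (a\<^sup>2 + w \<bullet> w + b\<^sup>2)" by (rule kappa_form_le) simp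
  finally show ?thesis by (simp add: y power2_eq_square add.assoc)
qed

text \<open>The prefactor is the dimension of the lifted space, and \<open>theta\<close> appears in
  the exponent as the ratio of the norm bound to the least second-moment eigenvalue.\<close>

lemma (in prob_space) uniform_points_incoherence_tail:
  fixes x :: "'n::finite \<Rightarrow> 'd::finite \<Rightarrow> 'a \<Rightarrow> real"
  assumes indep: "indep_vars (\<lambda>_. borel) (\<lambda>(i, j). x i j) (UNIV :: ('n \<times> 'd) set)"
    and unif: "\<And>i j. distr M borel (x i j) = uniform_measure lborel {-1..1}"
    and t: "0 < t" "t \<le> 1"
    and A: "A \<in> events"
    and small: "\<And>\<omega>. \<omega> \<in> A \<Longrightarrow>
      \<exists>v. norm v = 1 \<and> (\<Sum>i\<in>UNIV. (lift_point (\<chi> j. x i j \<omega>) \<bullet> v)\<^sup>2) \<le> t * (real CARD('n) * kappa CARD('d))"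
  shows "prob A \<le> (real CARD('d) + 2) * exp (- (real CARD('n) * (1 - t)\<^sup>2 / (2 * theta CARD('d))))"
proof -
  define R where "R = 1 + real CARD('d) + (real CARD('d))\<^sup>2"
  define X where "X = (\<lambda>i \<omega>. lift_point (\<chi> j. x i j \<omega>))"
  have R: "0 < R" by (simp add: R_def add_pos_nonneg)
  have \<kappa>: "0 < kappa CARD('d)" "kappa CARD('d) \<le> R"
    using kappa_pos[of "CARD('d)"] kappa_le[of "CARD('d)"] by (simp_all add: R_def add_increasing2)
  have rv[measurable]: "x i j \<in> borel_measurable M" for i j
    using indep_vars_fixed_row[OF indep, of i] by (simp add: indep_vars_def)
  have AE1: "AE \<omega> in M. \<bar>x i j \<omega>\<bar> \<le> 1" for i j
    by (rule AE_uniform_abs_le_1[OF rv unif])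
  have "indep_vars (\<lambda>_. borel) (\<lambda>i \<omega>. lift_point (\<chi> j. (\<lambda>(k, j) \<in> {i} \<times> UNIV. x k j \<omega>) (i, j))) UNIV"
  proof (rule indep_vars_rows[OF indep, of "\<lambda>i f. lift_point (\<chi> j. f (i, j))"])
    fix i :: 'n
    have [measurable]: "(\<lambda>f :: 'n \<times> 'd \<Rightarrow> real. \<chi> j. f (i, j)) \<in> borel_measurable (PiM ({i} \<times> UNIV) (\<lambda>_. borel))"
      by (rule borel_measurable_vec) (simp add: measurable_component_singleton)
    show "(\<lambda>f :: 'n \<times> 'd \<Rightarrow> real. lift_point (\<chi> j. f (i, j))) \<in> borel_measurable (PiM ({i} \<times> UNIV) (\<lambda>_. borel))"
      unfolding lift_point_def by (intro borel_measurable_Pair borel_measurable_inner) measurable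
  qed
  then have indep_X: "indep_vars (\<lambda>_. borel) X UNIV" by (simp add: X_def)
  have bounded: "AE \<omega> in M. X i \<omega> \<bullet> X i \<omega> \<le> R" for i
  proof -
    have "AE \<omega> in M. \<forall>j\<in>(UNIV :: 'd set). \<bar>x i j \<omega>\<bar> \<le> 1" by (intro AE_finite_allI AE1) simp
    then show ?thesis by eventually_elim (simp add: X_def R_def lift_point_norm_le)
  qed
  have second: "kappa CARD('d) * (y \<bullet> y) \<le> expectation (\<lambda>\<omega>. (X i \<omega> \<bullet> y)\<^sup>2)" for i y
    unfolding X_def by (rule lift_point_second_moment[OF indep_vars_fixed_row[OF indep] unif])
  have "prob A \<le> real DIM(real \<times> (real^'d) \<times> real) *
      exp (- (real CARD('n) * kappa CARD('d) * (1 - t)\<^sup>2 / (2 * R)))"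
    using small \<kappa>
    by (intro gram_Chernoff_lower_tail[OF finite _ indep_X bounded second R _ _ t A]) (auto simp: X_def)
  also have "real CARD('n) * kappa CARD('d) * (1 - t)\<^sup>2 / (2 * R) = real CARD('n) * (1 - t)\<^sup>2 / (2 * theta CARD('d))"
  proof -
    have theta: "theta CARD('d) = R / kappa CARD('d)" by (simp add: theta_eq R_def)
    show ?thesis unfolding theta using \<kappa> R by (simp add: field_simps)
  qed
  also have "real DIM(real \<times> (real^'d) \<times> real) = real CARD('d) + 2" by simp
  finally show ?thesis .
qed

theorem corollary1:
  fixes M :: "'a measure"
    and x :: "'n::finite \<Rightarrow> 'd::finite \<Rightarrow> 'a \<Rightarrow> real"
    and t \<gamma> :: real
  assumes "prob_space M"
    and "prob_space.indep_vars M (\<lambda>_. borel) (\<lambda>(i, j). x i j) (UNIV :: ('n \<times> 'd) set)"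
    and "\<And>i j. distr M borel (x i j) = uniform_measure lborel {-1..1}"
    and "0 < t" "t < 1"
    and "0 < \<gamma>" "\<gamma> \<le> 1"
    and "real CARD('n) \<ge>
           2 * theta CARD('d) * (ln (real CARD('d) + 2) - ln \<gamma>) / (1 - t)\<^sup>2"
  shows "measure M {\<omega> \<in> space M.
             A0 (CARD('d) + 2) (theta CARD('d) / (t * (real CARD('d) + 2)))
               (edm (\<lambda>i. \<chi> j. x i j \<omega>)) \<and>
             A1 (CARD('d) + 2) (theta CARD('d) / (t * sqrt (real CARD('d) + 2)))
               (edm (\<lambda>i. \<chi> j. x i j \<omega>))}
           \<ge> 1 - \<gamma>"
proof -
  interpret prob_space M by fact
  define N where "N = real CARD('n)"
  define d where "d = real CARD('d)"
  define \<theta> where "\<theta> = theta CARD('d)"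
  define \<kappa> where "\<kappa> = kappa CARD('d)"
  define R where "R = 1 + d + d\<^sup>2"
  define p where "p = (\<lambda>\<omega> i. \<chi> j. x i j \<omega>)"
  define G where "G = {E :: real^'n^'n. A0 (CARD('d) + 2) (\<theta> / (t * (d + 2))) E \<and> A1 (CARD('d) + 2) (\<theta> / (t * sqrt (d + 2))) E}"
  define good where "good = {\<omega> \<in> space M. edm (p \<omega>) \<in> G}"
  have N: "0 < N" and d: "0 < d" by (simp_all add: N_def d_def)
  have \<kappa>: "0 < \<kappa>" using kappa_pos[of "CARD('d)"] by (simp add: \<kappa>_def)
  have R: "0 < R" using d by (simp add: R_def add_pos_nonneg)
  have \<theta>: "\<theta> = R / \<kappa>" by (simp add: \<theta>_def \<kappa>_def R_def d_def theta_eq)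
  have \<theta>_pos: "0 < \<theta>" using R \<kappa> by (simp add: \<theta>)
  have rv[measurable]: "x i j \<in> borel_measurable M" for i j
    using indep_vars_fixed_row[OF assms(2), of i] by (simp add: indep_vars_def)
  have "(\<lambda>\<omega>. edm (p \<omega>)) \<in> borel_measurable M"
    by (intro borel_measurable_vec)
      (simp add: edm_def p_def power2_norm_eq_inner inner_vec_def)
  from measurable_sets[OF this borel_A0_A1] have good: "good \<in> events"
    unfolding good_def G_def by (simp add: vimage_def Int_def conj_commute)
  \<comment> \<open>The bound \<open>R\<close> on the lifted norms holds only almost surely.
    Discarding the null set where some coordinate leaves \<open>[-1, 1]\<close> makes the
    deterministic criterion applicable at every point of \<open>bad\<close>.\<close>
  define bad where "bad = {\<omega> \<in> space M - good. \<forall>i j. \<bar>x i j \<omega>\<bar> \<le> 1}"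
  have bad: "bad \<in> events" unfolding bad_def using good by measurable
  have AE1: "AE \<omega> in M. \<forall>i j. \<bar>x i j \<omega>\<bar> \<le> 1"
    using AE_uniform_abs_le_1[OF rv assms(3)] by (simp add: AE_all_countable)
  have small: "\<exists>v. norm v = 1 \<and> (\<Sum>i\<in>UNIV. (lift_point (p \<omega> i) \<bullet> v)\<^sup>2) \<le> t * (N * \<kappa>)"
    if \<omega>: "\<omega> \<in> bad" for \<omega>
  proof (rule ccontr)
    assume "\<not> ?thesis"
    then have large: "t * (N * \<kappa>) < (\<Sum>i\<in>UNIV. (lift_point (p \<omega> i) \<bullet> v)\<^sup>2)" if "norm v = 1" for v
      using that by (meson not_le)
    \<comment> \<open>At this threshold \<open>N * R / \<beta> = \<theta> / t\<close>, the origin of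
      both incoherence constants.\<close>
    define \<beta> where "\<beta> = t * (N * \<kappa>)"
    have \<beta>: "0 < \<beta>" using assms(4) N \<kappa> by (simp add: \<beta>_def)
    have form: "\<beta> * (v \<bullet> v) \<le> (\<Sum>i\<in>UNIV. (lift_point (p \<omega> i) \<bullet> v)\<^sup>2)" for v
    proof (cases "v = 0")
      case False
      define u where "u = (1 / norm v) *\<^sub>R v"
      have u: "norm u = 1" using False by (simp add: u_def)
      have "\<beta> * (v \<bullet> v) = (norm v)\<^sup>2 * \<beta>" by (simp add: power2_norm_eq_inner)
      also have "\<dots> \<le> (norm v)\<^sup>2 * (\<Sum>i\<in>UNIV. (lift_point (p \<omega> i) \<bullet> u)\<^sup>2)"
        using large[OF u] by (intro mult_left_mono) (auto simp: \<beta>_def)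
      also have "\<dots> = (\<Sum>i\<in>UNIV. (lift_point (p \<omega> i) \<bullet> v)\<^sup>2)"
        using False by (simp add: sum_distrib_left u_def power_divide)
      finally show ?thesis .
    qed simp
    have lift: "lift_point (p \<omega> i) \<bullet> lift_point (p \<omega> i) \<le> R" for i
      unfolding R_def d_def by (rule lift_point_norm_le) (use \<omega> in \<open>simp add: bad_def p_def\<close>)
    have \<mu>\<^sub>0: "N / real (CARD('d) + 2) * (R / \<beta>) = \<theta> / (t * (d + 2))"
      using N \<kappa> assms(4) d by (simp add: \<theta> \<beta>_def d_def field_simps)
    have \<mu>\<^sub>1: "R / \<beta> = \<theta> / (t * sqrt (d + 2)) * sqrt (real (CARD('d) + 2) / (N * N))"
      using N \<kappa> assms(4) d by (simp add: \<theta> \<beta>_def d_def[symmetric] real_sqrt_divide field_simps)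
    have "edm (p \<omega>) \<in> G"
      unfolding G_def mem_Collect_eq
      by (rule edm_A0_A1[OF \<beta> form lift eq_refl[OF \<mu>\<^sub>0[unfolded N_def]] eq_refl[OF \<mu>\<^sub>1[unfolded N_def]]])
    then show False using \<omega> by (auto simp: bad_def good_def)
  qed
  have "prob bad \<le> (d + 2) * exp (- (N * (1 - t)\<^sup>2 / (2 * \<theta>)))"
    unfolding N_def d_def \<theta>_def using assms(4,5) small
    by (intro uniform_points_incoherence_tail[OF assms(2,3) _ _ bad]) (auto simp: N_def \<kappa>_def p_def)
  also have "\<dots> \<le> (d + 2) * exp (ln \<gamma> - ln (d + 2))"
  proof -
    have "2 * \<theta> * (ln (d + 2) - ln \<gamma>) \<le> N * (1 - t)\<^sup>2"
      using assms(5,8) by (simp add: N_def d_def \<theta>_def field_simps)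
    then have "ln (d + 2) - ln \<gamma> \<le> N * (1 - t)\<^sup>2 / (2 * \<theta>)"
      using \<theta>_pos by (simp add: field_simps)
    then show ?thesis using d by simp
  qed
  also have "\<dots> = \<gamma>" using assms(6) d by (simp add: exp_diff)
  finally have "prob bad \<le> \<gamma>" .
  moreover have "prob bad = prob (space M - good)"
    using AE1 bad good by (intro finite_measure_eq_AE) (auto simp: bad_def elim!: eventually_mono)
  ultimately have "1 - \<gamma> \<le> prob good" using prob_compl[OF good] by simp
  then show ?thesis by (simp add: good_def G_def p_def d_def \<theta>_def)
qed

end
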